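(* Let $\Sigma_1,\Sigma_2\in\mathrm{Sym}^+(n,k)$ and set $P_1=\mathrm{Im}(\Sigma_1)$, $P_2=\mathrm{Im}(\Sigma_2)$. Then there exists a bijection between the index sets $I_{\mathrm{Gr}}(P_1,P_2)$ and $I_{BW}(\Sigma_1,\Sigma_2)$.
   Context: $\mathrm{Sym}^+(n,k)$ is the set of real symmetric positive semidefinite $n\times n$ matrices of rank $k$; $\mathrm{Im}$ is the column space; $\mathrm{Cov}(k)$ is the set of symmetric positive semidefinite $k\times k$ matrices; $\mathrm{St}(n,k)$ is the set of real $n\times k$ matrices with orthonormal columns. Principal angles: for $k$-dimensional subspaces $P_i=\mathrm{Span}(Q_i)$ of $\mathbb{R}^n$, $Q_i\in\mathrm{St}(n,k)$, $i=1,2$, they are the numbers $0\le\theta_1\le\dots\le\theta_k\le\pi/2$ such that the singular values of $Q_1^\top Q_2$ are $\cos\theta_1,\dots,\cos\theta_k$. Put $r:=\#\{i:\theta_i=\pi/2\}$. The index set of minimizing logarithms between $P_1$ and $P_2$ on the Grassmannian $\mathrm{Gr}(k,n)$ (with the Euclidean/Frobenius metric) is $$I_{\mathrm{Gr}}(P_1,P_2):=\{\mathrm{diag}(Q,I_{k-r}): Q\in O(r)\}$$ (with $O(0)$ trivial). Choose full column-rank real $n\times k$ matrices $X,Y$ with $\Sigma_1=XX^\top$, $\Sigma_2=YY^\top$. The index set of minimizing Bures--Wasserstein logarithms between $\Sigma_1$ and $\Sigma_2$ is $$I_{BW}(\Sigma_1,\Sigma_2):=\{R\in O(k):X^\top YR\in\mathrm{Cov}(k)\}=\{R\in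 O(k):X^\top YR=(X^\top\Sigma_2X)^{1/2}\},$$ where $(\cdot)^{1/2}$ is the positive semidefinite square root. *)

theory Defs
  imports
    Complex_Main
    "Jordan_Normal_Form.Char_Poly"
    "Jordan_Normal_Form.DL_Rank"
begin

text \<open>The sizes \<open>n\<close>, \<open>k\<close> and, crucially, the data-dependent block size \<open>r\<close> are natural numbers,
  so matrices are the carrier-based ones of Jordan_Normal_Form. Subspaces of \<open>\<real>\<^sup>n\<close> are sets of vectors.\<close>

definition Cov :: "nat \<Rightarrow> real mat set" where
  "Cov k = {A \<in> carrier_mat k k. A\<^sup>T = A \<and> (\<forall>v \<in> carrier_vec k. 0 \<le> v \<bullet> (A *\<^sub>v v))}"

definition Sym_plus :: "nat \<Rightarrow> nat \<Rightarrow> real mat set" where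
  "Sym_plus n k = {A \<in> Cov n. vec_space.rank n A = k}"

definition Stiefel :: "nat \<Rightarrow> nat \<Rightarrow> real mat set" where
  "Stiefel n k = {Q \<in> carrier_mat n k. Q\<^sup>T * Q = 1\<^sub>m k}"

text \<open>Jordan_Normal_Form's \<^const>\<open>orthogonal_mat\<close> does not require the columns to be
  normalised, hence a separate definition.\<close>

definition orthogonal_group :: "nat \<Rightarrow> real mat set" where
  "orthogonal_group m = {Q \<in> carrier_mat m m. Q\<^sup>T * Q = 1\<^sub>m m \<and> Q * Q\<^sup>T = 1\<^sub>m m}"

text \<open>Singular values with multiplicity: square roots of the eigenvalues of \<open>A\<^sup>T A\<close>, each
  repeated according to its multiplicity as a root of the characteristic polynomial. For a wide
  matrix this would contain additional zeros; it is used for square matrices only.\<close>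

definition singular_values :: "real mat \<Rightarrow> real multiset" where
  "singular_values A = image_mset sqrt (proots (char_poly (A\<^sup>T * A)))"

definition is_principal_angles ::
    "nat \<Rightarrow> nat \<Rightarrow> real vec set \<Rightarrow> real vec set \<Rightarrow> real list \<Rightarrow> bool" where
  "is_principal_angles n k P\<^sub>1 P\<^sub>2 \<theta> \<longleftrightarrow>
     length \<theta> = k \<and> sorted \<theta> \<and> set \<theta> \<subseteq> {0..pi/2} \<and>
     (\<exists>Q\<^sub>1 \<in> Stiefel n k. \<exists>Q\<^sub>2 \<in> Stiefel n k.
        vec_space.col_space n Q\<^sub>1 = P\<^sub>1 \<and> vec_space.col_space n Q\<^sub>2 = P\<^sub>2 \<and>
        singular_values (Q\<^sub>1\<^sup>T * Q\<^sub>2) = mset (map cos \<theta>))"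

text \<open>For \<open>k\<close>-dimensional subspaces the list exists and is unique: changing \<open>Q\<^sub>i\<close> multiplies
  \<open>Q\<^sub>1\<^sup>T Q\<^sub>2\<close> by orthogonal matrices, and \<open>cos\<close> is injective on \<open>[0, \<pi>/2]\<close>.\<close>

definition principal_angles ::
    "nat \<Rightarrow> nat \<Rightarrow> real vec set \<Rightarrow> real vec set \<Rightarrow> real list" where
  "principal_angles n k P\<^sub>1 P\<^sub>2 = (THE \<theta>. is_principal_angles n k P\<^sub>1 P\<^sub>2 \<theta>)"

definition num_right_angles ::
    "nat \<Rightarrow> nat \<Rightarrow> real vec set \<Rightarrow> real vec set \<Rightarrow> nat" where
  "num_right_angles n k P\<^sub>1 P\<^sub>2 = card {i. i < k \<and> principal_angles n k P\<^sub>1 P\<^sub>2 ! i = pi/2}"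

text \<open>The matrices \<open>diag(Q, I\<^sub>k\<^sub>-\<^sub>r)\<close> with \<open>Q \<in> O(r)\<close>; \<open>O(0)\<close> consists of the empty matrix, so for
  \<open>r = 0\<close> this is \<open>{I\<^sub>k}\<close>.\<close>

definition index_Gr :: "nat \<Rightarrow> nat \<Rightarrow> real vec set \<Rightarrow> real vec set \<Rightarrow> real mat set" where
  "index_Gr n k P\<^sub>1 P\<^sub>2 =
     (let r = num_right_angles n k P\<^sub>1 P\<^sub>2 in
      {four_block_mat Q (0\<^sub>m r (k - r)) (0\<^sub>m (k - r) r) (1\<^sub>m (k - r)) | Q.
         Q \<in> orthogonal_group r})"

text \<open>The index set for \<open>\<Sigma>\<^sub>1 = X X\<^sup>T\<close>, \<open>\<Sigma>\<^sub>2 = Y Y\<^sup>T\<close>. As a set of matrices it depends on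
  the chosen factors, which are therefore its arguments.\<close>

definition index_BW :: "nat \<Rightarrow> real mat \<Rightarrow> real mat \<Rightarrow> real mat set" where
  "index_BW k X Y = {R \<in> orthogonal_group k. X\<^sup>T * Y * R \<in> Cov k}"

end

theory Submission
  imports Defs
begin

text \<open>
Both index sets are copies of the orthogonal group \<open>O(r)\<close>, where \<open>r\<close> is the nullity of \<open>M = X\<^sup>T Y\<close>.

Take a singular value decomposition \<open>M = U D V\<^sup>T\<close> with the \<open>r\<close> vanishing singular values in front
(\<open>svd_exists\<close>). With \<open>R = V W U\<^sup>T\<close>, the matrix \<open>M R\<close> is positive semidefinite iff \<open>D W\<close> is. If so,
\<open>D W\<close> is a positive semidefinite square root of \<open>D W W\<^sup>T D = D\<^sup>2\<close>, hence \<open>D W = D\<close>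
(\<open>Cov_square_eq_diag\<close>), which for orthogonal \<open>W\<close> means \<open>W = diag(Q, I)\<close> with \<open>Q \<in> O(r)\<close>
(\<open>diag_mult_orthogonal_Cov_iff\<close>). So \<open>W \<mapsto> V W U\<^sup>T\<close> maps the matrices \<open>diag(Q, I)\<close> bijectively onto the
Bures--Wasserstein index set (\<open>index_BW_svd\<close>).

The Grassmannian index set consists of the matrices \<open>diag(Q, I)\<close> whose block size is the
number of right principal angles, that is, of vanishing singular values of \<open>Q\<^sub>1\<^sup>T Q\<^sub>2\<close> for
orthonormal bases \<open>Q\<^sub>1\<close>, \<open>Q\<^sub>2\<close> of the two subspaces (\<open>num_right_angles_svd\<close>). As \<open>X = Q\<^sub>1 G\<close> and
\<open>Y = Q\<^sub>2 H\<close> with invertible \<open>G\<close> and \<open>H\<close> (\<open>Stiefel_factorization\<close>), the matrices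
\<open>M = G\<^sup>T (Q\<^sub>1\<^sup>T Q\<^sub>2) H\<close> and \<open>Q\<^sub>1\<^sup>T Q\<^sub>2\<close> have the same nullity (\<open>svd_nullity_le\<close>), although their
positive singular values differ in general. So the block sizes agree.
\<close>

section \<open>Orthogonal matrices and real vectors\<close>

lemma orthogonal_groupD:
  assumes "Q \<in> orthogonal_group m"
  shows "Q \<in> carrier_mat m m" "Q\<^sup>T \<in> carrier_mat m m" "Q\<^sup>T * Q = 1\<^sub>m m" "Q * Q\<^sup>T = 1\<^sub>m m"
  using assms unfolding orthogonal_group_def by auto

lemma orthogonal_groupI:
  assumes "Q \<in> carrier_mat m m" "Q\<^sup>T * Q = 1\<^sub>m m"
  shows "Q \<in> orthogonal_group m"
  using assms mat_mult_left_right_inverse[of "Q\<^sup>T" m Q] unfolding orthogonal_group_def by auto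

lemma orthogonal_group_one: "1\<^sub>m m \<in> orthogonal_group m"
  by (rule orthogonal_groupI) auto

lemma orthogonal_group_transpose: "Q \<in> orthogonal_group m \<Longrightarrow> Q\<^sup>T \<in> orthogonal_group m"
  unfolding orthogonal_group_def by auto

lemma transpose_mult_cancel:
  fixes A :: "real mat"
  assumes "Q \<in> orthogonal_group m" "A \<in> carrier_mat m l"
  shows "Q\<^sup>T * (Q * A) = A" "Q * (Q\<^sup>T * A) = A"
  using assms orthogonal_groupD[OF assms(1)]
  by (simp_all flip: assoc_mult_mat[of _ m m _ m _ l])

lemma orthogonal_group_mult:
  assumes "P \<in> orthogonal_group m" "Q \<in> orthogonal_group m"
  shows "P * Q \<in> orthogonal_group m"
proof (rule orthogonal_groupI)
  note P = orthogonal_groupD[OF assms(1)] and Q = orthogonal_groupD[OF assms(2)]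
  show "P * Q \<in> carrier_mat m m" using P Q by auto
  have "(P * Q)\<^sup>T * (P * Q) = Q\<^sup>T * (P\<^sup>T * (P * Q))"
    using P Q by (simp add: transpose_mult[of P m m Q m] assoc_mult_mat[of _ m m _ m _ m])
  thus "(P * Q)\<^sup>T * (P * Q) = 1\<^sub>m m"
    using transpose_mult_cancel(1)[OF assms(1) Q(1)] Q(3) by simp
qed

lemma scalar_prod_self_sum: "(v :: real vec) \<bullet> v = (\<Sum>i<dim_vec v. (v $ i)\<^sup>2)"
  by (simp add: scalar_prod_def power2_eq_square atLeast0LessThan)

lemma scalar_prod_self_nonneg: "0 \<le> (v :: real vec) \<bullet> v"
  by (simp add: scalar_prod_self_sum sum_nonneg)

lemma scalar_prod_self_eq_0:
  assumes "(v :: real vec) \<in> carrier_vec n" "v \<bullet> v = 0"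
  shows "v = 0\<^sub>v n"
proof (rule eq_vecI)
  have "\<forall>i\<in>{..<dim_vec v}. (v $ i)\<^sup>2 = 0"
    using assms(2) by (simp add: scalar_prod_self_sum sum_nonneg_eq_0_iff)
  thus "\<And>i. i < dim_vec (0\<^sub>v n) \<Longrightarrow> v $ i = 0\<^sub>v n $ i" using assms(1) by auto
qed (use assms in auto)

lemma normalize_vec:
  assumes "(v :: real vec) \<in> carrier_vec n" "v \<noteq> 0\<^sub>v n"
  obtains c where "c \<noteq> 0" "(c \<cdot>\<^sub>v v) \<bullet> (c \<cdot>\<^sub>v v) = 1"
proof
  have "0 < v \<bullet> v"
    using scalar_prod_self_nonneg[of v] scalar_prod_self_eq_0[OF assms(1)] assms(2) by force
  thus "1 / sqrt (v \<bullet> v) \<noteq> 0"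
    "(1 / sqrt (v \<bullet> v) \<cdot>\<^sub>v v) \<bullet> (1 / sqrt (v \<bullet> v) \<cdot>\<^sub>v v) = 1"
    using assms(1) by (auto simp: field_simps)
qed

lemma symmetric_mat_scalar_prod:
  fixes A :: "real mat"
  assumes "A \<in> carrier_mat n n" "A\<^sup>T = A" "v \<in> carrier_vec n" "w \<in> carrier_vec n"
  shows "v \<bullet> (A *\<^sub>v w) = (A *\<^sub>v v) \<bullet> w"
  using transpose_vec_mult_scalar[of A n n w v] assms
  by (metis mult_mat_vec_carrier comm_scalar_prod)

text \<open>Split a complex eigenvector for the eigenvalue \<open>l\<close> into real and imaginary part, \<open>w = x + \<i> y\<close>.
Expanding both sides of \<open>x \<bullet> A y = A x \<bullet> y\<close> leaves \<open>Im l * (x \<bullet> x + y \<bullet> y) = 0\<close>, so \<open>l\<close> is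
real and whichever of \<open>x\<close>, \<open>y\<close> is nonzero is a real eigenvector.\<close>

lemma symmetric_real_eigenvector:
  fixes A :: "real mat"
  assumes A: "A \<in> carrier_mat n n" and sym: "A\<^sup>T = A" and n: "0 < n"
  obtains v e where "v \<in> carrier_vec n" "v \<bullet> v = 1" "A *\<^sub>v v = e \<cdot>\<^sub>v v"
proof -
  let ?C = "map_mat complex_of_real A"
  have C: "?C \<in> carrier_mat n n" using A by simp
  obtain as where as: "char_poly ?C = (\<Prod> a \<leftarrow> as. [:- a, 1:])" "length as = n"
    using char_poly_factorized[OF C] by blast
  then obtain l bs where "as = l # bs" using n by (cases as) auto
  hence "poly (char_poly ?C) l = 0" using as by simp
  hence "eigenvalue ?C l" using eigenvalue_root_char_poly[OF C] by simp
  then obtain w where w: "w \<in> carrier_vec n" "w \<noteq> 0\<^sub>v n" "?C *\<^sub>v w = l \<cdot>\<^sub>v w"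
    using C unfolding eigenvalue_def eigenvector_def by auto
  define x y where "x = map_vec Re w" and "y = map_vec Im w"
  have xy: "x \<in> carrier_vec n" "y \<in> carrier_vec n" using w by (auto simp: x_def y_def)
  have Cw: "(?C *\<^sub>v w) $ i = (\<Sum>j<n. complex_of_real (A $$ (i,j)) * w $ j)" if "i < n" for i
    using that A w(1) by (auto simp: scalar_prod_def atLeast0LessThan intro!: sum.cong)
  have Ax: "A *\<^sub>v x = Re l \<cdot>\<^sub>v x - Im l \<cdot>\<^sub>v y"
  proof (rule eq_vecI)
    fix i assume "i < dim_vec (Re l \<cdot>\<^sub>v x - Im l \<cdot>\<^sub>v y)"
    hence i: "i < n" using xy by simp
    have "(A *\<^sub>v x) $ i = (\<Sum>j<n. A $$ (i,j) * Re (w $ j))"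
      using i A w(1) by (auto simp: x_def scalar_prod_def atLeast0LessThan intro!: sum.cong)
    also have "\<dots> = Re ((?C *\<^sub>v w) $ i)" using Cw[OF i] by simp
    finally show "(A *\<^sub>v x) $ i = (Re l \<cdot>\<^sub>v x - Im l \<cdot>\<^sub>v y) $ i"
      using i w(1) by (simp add: w(3) x_def y_def)
  qed (use A xy in auto)
  have Ay: "A *\<^sub>v y = Im l \<cdot>\<^sub>v x + Re l \<cdot>\<^sub>v y"
  proof (rule eq_vecI)
    fix i assume "i < dim_vec (Im l \<cdot>\<^sub>v x + Re l \<cdot>\<^sub>v y)"
    hence i: "i < n" using xy by simp
    have "(A *\<^sub>v y) $ i = (\<Sum>j<n. A $$ (i,j) * Im (w $ j))"
      using i A w(1) by (auto simp: y_def scalar_prod_def atLeast0LessThan intro!: sum.cong)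
    also have "\<dots> = Im ((?C *\<^sub>v w) $ i)" using Cw[OF i] by simp
    finally show "(A *\<^sub>v y) $ i = (Im l \<cdot>\<^sub>v x + Re l \<cdot>\<^sub>v y) $ i"
      using i w(1) by (simp add: w(3) x_def y_def)
  qed (use A xy in auto)
  have nz: "x \<noteq> 0\<^sub>v n \<or> y \<noteq> 0\<^sub>v n"
  proof (rule ccontr)
    assume "\<not> ?thesis"
    hence z: "x = 0\<^sub>v n" "y = 0\<^sub>v n" by auto
    have "w = 0\<^sub>v n"
    proof (rule eq_vecI)
      fix i assume "i < dim_vec (0\<^sub>v n :: complex vec)"
      hence i: "i < n" by simp
      have "Re (w $ i) = x $ i" "Im (w $ i) = y $ i" using i w(1) by (auto simp: x_def y_def)
      thus "w $ i = 0\<^sub>v n $ i" using i z by (simp add: complex_eq_iff)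
    qed (use w in auto)
    thus False using w by simp
  qed
  have "x \<bullet> (A *\<^sub>v y) = (A *\<^sub>v x) \<bullet> y" by (rule symmetric_mat_scalar_prod[OF A sym xy])
  hence "Im l * (x \<bullet> x + y \<bullet> y) = 0"
    using xy unfolding Ax Ay
    by (simp add: scalar_prod_add_distrib[of _ n] minus_scalar_prod_distrib[of _ n] algebra_simps)
  moreover have "x \<bullet> x + y \<bullet> y \<noteq> 0"
    using nz scalar_prod_self_nonneg[of x] scalar_prod_self_nonneg[of y]
      scalar_prod_self_eq_0[OF xy(1)] scalar_prod_self_eq_0[OF xy(2)] by linarith
  ultimately have l: "Im l = 0" by simp
  have Ax': "A *\<^sub>v x = Re l \<cdot>\<^sub>v x" and Ay': "A *\<^sub>v y = Re l \<cdot>\<^sub>v y"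
    using Ax Ay l xy by auto
  obtain z where z: "z \<in> carrier_vec n" "z \<noteq> 0\<^sub>v n" "A *\<^sub>v z = Re l \<cdot>\<^sub>v z"
    using nz Ax' Ay' xy by blast
  obtain c where c: "c \<noteq> 0" "(c \<cdot>\<^sub>v z) \<bullet> (c \<cdot>\<^sub>v z) = 1" using normalize_vec[OF z(1,2)] .
  show thesis
  proof (rule that)
    show "c \<cdot>\<^sub>v z \<in> carrier_vec n" using z by simp
    show "(c \<cdot>\<^sub>v z) \<bullet> (c \<cdot>\<^sub>v z) = 1" by (rule c)
    show "A *\<^sub>v (c \<cdot>\<^sub>v z) = Re l \<cdot>\<^sub>v (c \<cdot>\<^sub>v z)"
      using z A by (simp add: mult_mat_vec[of A n n] smult_smult_assoc mult.commute)
  qed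
qed

text \<open>The Householder reflection in the hyperplane orthogonal to \<open>w = u - e\<^sub>0\<close> exchanges the unit vectors
\<open>e\<^sub>0\<close> and \<open>u\<close>. It is undefined when \<open>u = e\<^sub>0\<close>, where the identity serves.\<close>

lemma orthogonal_completion:
  fixes u :: "real vec"
  assumes u: "u \<in> carrier_vec n" and unit: "u \<bullet> u = 1" and n: "0 < n"
  obtains W where "W \<in> orthogonal_group n" "col W 0 = u"
proof (cases "u = unit_vec n 0")
  case True
  show thesis using that[OF orthogonal_group_one[of n]] True n by simp
next
  case False
  define w where "w = u - unit_vec n 0"
  define s where "s = w \<bullet> w"
  define W where "W = mat n n (\<lambda>(i,j). (if i = j then 1 else 0) - 2 / s * (w $ i * w $ j))"
  have w: "w \<in> carrier_vec n" using u by (simp add: w_def)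
  have "w \<noteq> 0\<^sub>v n"
  proof
    assume "w = 0\<^sub>v n"
    hence "w $ i = 0" if "i < n" for i using that by simp
    hence "u = unit_vec n 0" using u by (intro eq_vecI) (auto simp: w_def)
    thus False using False by simp
  qed
  hence s0: "s \<noteq> 0" using scalar_prod_self_eq_0[OF w] by (auto simp: s_def)
  have s: "s = (\<Sum>l<n. w $ l * w $ l)"
    using w by (simp add: s_def scalar_prod_def atLeast0LessThan)
  have su: "s = 2 - 2 * u $ 0"
    using u n unit unfolding s_def w_def
    by (simp add: scalar_prod_minus_distrib[of _ n] minus_scalar_prod_distrib[of _ n])
  have "(W\<^sup>T * W) $$ (i,j) = 1\<^sub>m n $$ (i,j)" if ij: "i < n" "j < n" for i j
  proof -
    have "(W\<^sup>T * W) $$ (i,j) = (\<Sum>l<n. ((if l = i then 1 else 0) - 2 / s * (w $ l * w $ i)) *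
        ((if l = j then 1 else 0) - 2 / s * (w $ l * w $ j)))"
      using ij by (simp add: W_def scalar_prod_def atLeast0LessThan)
    also have "\<dots> = (\<Sum>l<n. (if l = i then (if i = j then 1 else 0) else 0)
        - (if l = i then 2 / s * (w $ i * w $ j) else 0)
        - (if l = j then 2 / s * (w $ j * w $ i) else 0)
        + (2 / s)\<^sup>2 * (w $ i * w $ j) * (w $ l * w $ l))"
      by (rule sum.cong) (auto simp: algebra_simps power2_eq_square)
    also have "\<dots> = (if i = j then 1 else 0) - 2 / s * (w $ i * w $ j) - 2 / s * (w $ j * w $ i)
        + (2 / s)\<^sup>2 * (w $ i * w $ j) * s"
      using ij by (simp add: sum.distrib sum_subtractf sum_distrib_left[symmetric] s[symmetric])
    also have "\<dots> = (if i = j then 1 else 0)"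
      using s0 by (simp add: power2_eq_square field_simps)
    finally show ?thesis using ij by simp
  qed
  hence "W\<^sup>T * W = 1\<^sub>m n" by (intro eq_matI) (auto simp: W_def)
  hence "W \<in> orthogonal_group n" by (intro orthogonal_groupI) (auto simp: W_def)
  moreover have "col W 0 = u"
  proof (rule eq_vecI)
    fix i assume "i < dim_vec u"
    hence i: "i < n" using u by simp
    have "2 / s * w $ 0 = -1" using su s0 n u by (simp add: w_def field_simps)
    hence "2 / s * (w $ i * w $ 0) = - w $ i" by (metis mult.left_commute mult_minus1_right)
    thus "col W 0 $ i = u $ i" using i n u by (simp add: W_def w_def)
  qed (use u in \<open>auto simp: W_def\<close>)
  ultimately show thesis by (rule that)
qed

section \<open>Singular value decomposition\<close>

text \<open>One more singular value is split off in each step of the induction that proves the singular value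
decomposition; this is the shape of the matrix after the split.\<close>

definition bordered :: "real \<Rightarrow> real mat \<Rightarrow> real mat" where
  "bordered s A = four_block_mat (mat 1 1 (\<lambda>_. s)) (0\<^sub>m 1 (dim_col A)) (0\<^sub>m (dim_row A) 1) A"

lemma bordered_carrier [simp]: "A \<in> carrier_mat n n \<Longrightarrow> bordered s A \<in> carrier_mat (Suc n) (Suc n)"
  by (auto simp: bordered_def)

lemma bordered_mult:
  assumes "A \<in> carrier_mat n n" "B \<in> carrier_mat n n"
  shows "bordered s A * bordered t B = bordered (s * t) (A * B)"
proof -
  have "mat 1 1 (\<lambda>_. s) * mat 1 1 (\<lambda>_. t) = mat 1 1 (\<lambda>_. s * t)"
    by (rule eq_matI) (auto simp: scalar_prod_def)
  thus ?thesis using assms unfolding bordered_def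
    by (subst mult_four_block_mat[of _ 1 1 _ n _ n _ _ 1 _ n]) auto
qed

lemma bordered_transpose:
  assumes "A \<in> carrier_mat n n"
  shows "(bordered s A)\<^sup>T = bordered s A\<^sup>T"
proof -
  have "(mat 1 1 (\<lambda>_. s))\<^sup>T = mat 1 1 (\<lambda>_. s)" by (rule eq_matI) auto
  thus ?thesis using assms unfolding bordered_def
    by (subst transpose_four_block_mat[of _ 1 1 _ n _ n]) auto
qed

lemma bordered_one: "bordered 1 (1\<^sub>m n) = 1\<^sub>m (Suc n)"
  by (rule eq_matI) (auto simp: bordered_def)

lemma bordered_orthogonal:
  assumes "Q \<in> orthogonal_group n"
  shows "bordered 1 Q \<in> orthogonal_group (Suc n)"
  using orthogonal_groupD[OF assms]
  by (intro orthogonal_groupI) (auto simp: bordered_transpose[of _ n] bordered_mult[of _ n] bordered_one)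

lemma bordered_mat_diag: "bordered s (mat_diag n d) = mat_diag (Suc n) (case_nat s d)"
  by (rule eq_matI) (auto simp: bordered_def mat_diag_def split: nat.split)

lemma det_bordered:
  assumes "A \<in> carrier_mat n n"
  shows "det (bordered s A) = s * det A"
proof -
  have "det (bordered s A) = det (mat 1 1 (\<lambda>_. s)) * det A"
    unfolding bordered_def using assms
    by (subst det_four_block_mat_lower_left_zero[of _ 1 _ n]) auto
  also have "det (mat 1 1 (\<lambda>_. s)) = s" by (subst det_single) auto
  finally show ?thesis .
qed

lemma bordered_of_unit_col_row:
  assumes B: "B \<in> carrier_mat (Suc n) (Suc n)"
    and c: "col B 0 = s \<cdot>\<^sub>v unit_vec (Suc n) 0" and r: "col B\<^sup>T 0 = s \<cdot>\<^sub>v unit_vec (Suc n) 0"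
  obtains C where "C \<in> carrier_mat n n" "B = bordered s C"
proof
  let ?C = "mat n n (\<lambda>(i,j). B $$ (Suc i, Suc j))"
  show "?C \<in> carrier_mat n n" by simp
  have "B $$ (i, 0) = (if i = 0 then s else 0)" if "i < Suc n" for i
    using arg_cong[OF c, of "\<lambda>v. v $ i"] that B by (auto simp: unit_vec_def)
  moreover have "B $$ (0, i) = (if i = 0 then s else 0)" if "i < Suc n" for i
    using arg_cong[OF r, of "\<lambda>v. v $ i"] that B by (auto simp: unit_vec_def)
  ultimately show "B = bordered s ?C"
    using B by (intro eq_matI) (auto simp: bordered_def)
qed

text \<open>The vanishing singular values come first. Hence \<open>r\<close> is the nullity of \<open>M\<close>, and the kernel of the
diagonal factor is spanned by the first \<open>r\<close> unit vectors, which matches the position of the free block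
in \<open>diag(Q, I)\<close>. The positive singular values are in no particular order.\<close>

definition svd :: "nat \<Rightarrow> real mat \<Rightarrow> real mat \<Rightarrow> (nat \<Rightarrow> real) \<Rightarrow> real mat \<Rightarrow> nat \<Rightarrow> bool" where
  "svd k M U d V r \<longleftrightarrow> U \<in> orthogonal_group k \<and> V \<in> orthogonal_group k \<and> r \<le> k \<and>
     (\<forall>i<k. 0 \<le> d i) \<and> (\<forall>i<k. d i = 0 \<longleftrightarrow> i < r) \<and> M = U * mat_diag k d * V\<^sup>T"

lemma det_mat_diag: "det (mat_diag k d) = (\<Prod>i<k. d i)"
proof -
  have "det (mat_diag k d) = prod_list (diag_mat (mat_diag k d))"
    by (rule det_upper_triangular[of _ k]) (auto simp: mat_diag_def)
  also have "diag_mat (mat_diag k d) = map d [0..<k]"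
    by (auto simp: diag_mat_def mat_diag_def)
  also have "prod_list (map d [0..<k]) = (\<Prod>i<k. d i)"
    by (simp add: prod.list_conv_set_nth[symmetric] prod.distinct_set_conv_list[symmetric] atLeast0LessThan)
  finally show ?thesis .
qed

lemma svd_det_nonzero:
  assumes "svd k M U d V r" "det M \<noteq> 0"
  shows "r = 0"
proof (rule ccontr)
  assume "r \<noteq> 0"
  hence "0 < k" "d 0 = 0" using assms(1) by (auto simp: svd_def)
  hence "det (mat_diag k d) = 0" by (auto simp: det_mat_diag)
  thus False using assms orthogonal_groupD[of U k] orthogonal_groupD[of V k]
    by (simp add: svd_def det_mult[of _ k])
qed

text \<open>If \<open>M\<close> is singular, unit vectors in the kernels of \<open>M\<close> and of its transpose give the pair with
\<open>s = 0\<close>. Otherwise \<open>v\<close> is an eigenvector of \<open>M\<^sup>T M\<close>, whose eigenvalue is the squared length of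
\<open>M v\<close> and thus positive, and \<open>u\<close> is the normalized \<open>M v\<close>. Preferring the value zero while
\<open>M\<close> is singular is what puts the zeros first in the decomposition.\<close>

lemma singular_vectors:
  fixes M :: "real mat"
  assumes M: "M \<in> carrier_mat n n" and n: "0 < n"
  obtains u v s where "u \<in> carrier_vec n" "v \<in> carrier_vec n" "u \<bullet> u = 1" "v \<bullet> v = 1"
    "M *\<^sub>v v = s \<cdot>\<^sub>v u" "M\<^sup>T *\<^sub>v u = s \<cdot>\<^sub>v v" "0 \<le> s" "s = 0 \<longleftrightarrow> det M = 0"
proof (cases "det M = 0")
  case True
  have kernel: "\<exists>v. v \<in> carrier_vec n \<and> v \<bullet> v = 1 \<and> A *\<^sub>v v = 0 \<cdot>\<^sub>v u"
    if A: "A \<in> carrier_mat n n" "det A = 0" and u: "u \<in> carrier_vec n" for A :: "real mat" and u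
  proof -
    obtain v where v: "v \<in> carrier_vec n" "v \<noteq> 0\<^sub>v n" "A *\<^sub>v v = 0\<^sub>v n"
      using det_0_iff_vec_prod_zero_field[OF A(1)] A(2) by blast
    obtain c where "c \<noteq> 0" "(c \<cdot>\<^sub>v v) \<bullet> (c \<cdot>\<^sub>v v) = 1" using normalize_vec[OF v(1,2)] .
    moreover have "A *\<^sub>v (c \<cdot>\<^sub>v v) = 0\<^sub>v n"
      using v A by (auto simp: mult_mat_vec[of A n n])
    ultimately show ?thesis using v u by (intro exI[of _ "c \<cdot>\<^sub>v v"]) auto
  qed
  obtain v where v: "v \<in> carrier_vec n" "v \<bullet> v = 1" "M *\<^sub>v v = 0 \<cdot>\<^sub>v 0\<^sub>v n"
    using kernel[OF M True, of "0\<^sub>v n"] by auto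
  obtain u where u: "u \<in> carrier_vec n" "u \<bullet> u = 1" "M\<^sup>T *\<^sub>v u = 0 \<cdot>\<^sub>v v"
    using kernel[of "M\<^sup>T" v] M True v(1) det_transpose[OF M] by auto
  have "M *\<^sub>v v = 0 \<cdot>\<^sub>v u" using v u by auto
  thus thesis using that[of u v 0] u v True by auto
next
  case False
  have MT: "M\<^sup>T \<in> carrier_mat n n" using M by simp
  have A: "M\<^sup>T * M \<in> carrier_mat n n" using M by simp
  have "(M\<^sup>T * M)\<^sup>T = M\<^sup>T * M" using M by (simp add: transpose_mult[of _ n n])
  then obtain v e where v: "v \<in> carrier_vec n" "v \<bullet> v = 1" "(M\<^sup>T * M) *\<^sub>v v = e \<cdot>\<^sub>v v"
    using symmetric_real_eigenvector[OF A _ n] by metis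
  define w where "w = M *\<^sub>v v"
  have w: "w \<in> carrier_vec n" using M v by (simp add: w_def)
  have MTw: "M\<^sup>T *\<^sub>v w = e \<cdot>\<^sub>v v"
    using v M by (simp add: w_def assoc_mult_mat_vec[of _ n n _ n])
  have "w \<bullet> w = (M\<^sup>T *\<^sub>v w) \<bullet> v"
    using transpose_vec_mult_scalar[of M n n v w] M v w by (simp add: w_def)
  hence ww: "w \<bullet> w = e" using MTw v by simp
  have "w \<noteq> 0\<^sub>v n"
    using det_0_iff_vec_prod_zero_field[OF M] False v by (auto simp: w_def)
  hence e: "0 < e"
    using ww scalar_prod_self_nonneg[of w] scalar_prod_self_eq_0[OF w] by force
  show thesis
  proof (rule that)
    show "1 / sqrt e \<cdot>\<^sub>v w \<in> carrier_vec n" using w by simp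
    show "v \<in> carrier_vec n" "v \<bullet> v = 1" by (rule v)+
    show "(1 / sqrt e \<cdot>\<^sub>v w) \<bullet> (1 / sqrt e \<cdot>\<^sub>v w) = 1" using w e ww by (simp add: field_simps)
    show "M *\<^sub>v v = sqrt e \<cdot>\<^sub>v (1 / sqrt e \<cdot>\<^sub>v w)"
      using e by (simp add: w_def smult_smult_assoc)
    have "M\<^sup>T *\<^sub>v (1 / sqrt e \<cdot>\<^sub>v w) = (e / sqrt e) \<cdot>\<^sub>v v"
      using w MT MTw by (simp add: mult_mat_vec[of _ n n] smult_smult_assoc)
    thus "M\<^sup>T *\<^sub>v (1 / sqrt e \<cdot>\<^sub>v w) = sqrt e \<cdot>\<^sub>v v" using e by (simp add: real_div_sqrt)
    show "0 \<le> sqrt e" "sqrt e = 0 \<longleftrightarrow> det M = 0" using e False by auto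
  qed
qed

text \<open>Complete the singular vectors \<open>u\<close>, \<open>v\<close> to orthogonal matrices \<open>U\<^sub>1\<close>, \<open>V\<^sub>1\<close>. Both the first column and the
first row of \<open>U\<^sub>1\<^sup>T M V\<^sub>1\<close> are then \<open>s\<close> times the first unit vector, and the induction
hypothesis applies to the remaining block.\<close>

lemma svd_exists:
  assumes "M \<in> carrier_mat k k"
  obtains U d V r where "svd k M U d V r"
proof -
  have "\<exists>U d V r. svd k M U d V r"
    using assms
  proof (induction k arbitrary: M)
    case 0
    have "svd 0 M (1\<^sub>m 0) (\<lambda>_. 0) (1\<^sub>m 0) 0"
      using 0 orthogonal_group_one[of 0] by (auto simp: svd_def)
    thus ?case by blast
  next
    case (Suc n)
    let ?k = "Suc n"
    have M: "M \<in> carrier_mat ?k ?k" by fact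
    obtain u v s where uv: "u \<in> carrier_vec ?k" "v \<in> carrier_vec ?k" "u \<bullet> u = 1" "v \<bullet> v = 1"
      "M *\<^sub>v v = s \<cdot>\<^sub>v u" "M\<^sup>T *\<^sub>v u = s \<cdot>\<^sub>v v" and s: "0 \<le> s" "s = 0 \<longleftrightarrow> det M = 0"
      using singular_vectors[OF M] by auto
    obtain U\<^sub>1 where U\<^sub>1: "U\<^sub>1 \<in> orthogonal_group ?k" "col U\<^sub>1 0 = u"
      using orthogonal_completion[OF uv(1,3)] by auto
    obtain V\<^sub>1 where V\<^sub>1: "V\<^sub>1 \<in> orthogonal_group ?k" "col V\<^sub>1 0 = v"
      using orthogonal_completion[OF uv(2,4)] by auto
    note U = orthogonal_groupD[OF U\<^sub>1(1)] and V = orthogonal_groupD[OF V\<^sub>1(1)]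
    have first_col: "col (P\<^sup>T * A * Q) 0 = s \<cdot>\<^sub>v unit_vec ?k 0"
      if "P \<in> orthogonal_group ?k" "Q \<in> orthogonal_group ?k" "A \<in> carrier_mat ?k ?k"
        "A *\<^sub>v col Q 0 = s \<cdot>\<^sub>v col P 0" for P A Q
    proof -
      note P = orthogonal_groupD[OF that(1)] and Q = orthogonal_groupD[OF that(2)]
      have "col (P\<^sup>T * A * Q) 0 = P\<^sup>T *\<^sub>v (A *\<^sub>v col Q 0)"
        unfolding col_mult2[OF mult_carrier_mat[OF P(2) that(3)] Q(1) zero_less_Suc]
        by (rule assoc_mult_mat_vec[OF P(2) that(3)]) (use Q(1) in \<open>auto intro!: col_carrier_vec\<close>)
      also have "\<dots> = s \<cdot>\<^sub>v (P\<^sup>T *\<^sub>v col P 0)"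
        unfolding that(4) by (rule mult_mat_vec[OF P(2)]) (use P(1) in \<open>auto intro!: col_carrier_vec\<close>)
      also have "P\<^sup>T *\<^sub>v col P 0 = col (P\<^sup>T * P) 0"
        by (rule col_mult2[OF P(2,1) zero_less_Suc, symmetric])
      finally show ?thesis using P(3) by simp
    qed
    define B where "B = U\<^sub>1\<^sup>T * M * V\<^sub>1"
    have B: "B \<in> carrier_mat ?k ?k" using M U V by (simp add: B_def)
    have BT: "B\<^sup>T = V\<^sub>1\<^sup>T * M\<^sup>T * U\<^sub>1"
      unfolding B_def using M U V by (simp add: transpose_mult[of _ ?k ?k _ ?k] assoc_mult_mat[of _ ?k ?k _ ?k _ ?k])
    have "col B 0 = s \<cdot>\<^sub>v unit_vec ?k 0"
      unfolding B_def by (rule first_col) (use U\<^sub>1 V\<^sub>1 M uv in auto)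
    moreover have "col B\<^sup>T 0 = s \<cdot>\<^sub>v unit_vec ?k 0"
      unfolding BT by (rule first_col) (use U\<^sub>1 V\<^sub>1 M uv in auto)
    ultimately obtain C where C: "C \<in> carrier_mat n n" "B = bordered s C"
      using bordered_of_unit_col_row[OF B] by blast
    obtain U\<^sub>2 d V\<^sub>2 r where IH: "svd n C U\<^sub>2 d V\<^sub>2 r" using Suc.IH[OF C(1)] by blast
    hence UV2: "U\<^sub>2 \<in> orthogonal_group n" "V\<^sub>2 \<in> orthogonal_group n"
      and d: "r \<le> n" "\<forall>i<n. 0 \<le> d i" "\<forall>i<n. d i = 0 \<longleftrightarrow> i < r" by (auto simp: svd_def)
    note U2 = orthogonal_groupD[OF UV2(1)] and V2 = orthogonal_groupD[OF UV2(2)]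
    have Bs: "B = bordered 1 U\<^sub>2 * mat_diag ?k (case_nat s d) * (bordered 1 V\<^sub>2)\<^sup>T"
      using IH U2 V2 C by (simp add: svd_def bordered_mat_diag[symmetric] bordered_transpose[of _ n] bordered_mult[of _ n])
    have c: "bordered 1 U\<^sub>2 \<in> carrier_mat ?k ?k" "bordered 1 V\<^sub>2 \<in> carrier_mat ?k ?k" using U2 V2 by auto
    have "M = U\<^sub>1 * B * V\<^sub>1\<^sup>T"
    proof -
      have "U\<^sub>1 * B * V\<^sub>1\<^sup>T = U\<^sub>1 * (U\<^sub>1\<^sup>T * (M * (V\<^sub>1 * V\<^sub>1\<^sup>T)))"
        unfolding B_def using M U(1,2) V(1,2) by (simp add: assoc_mult_mat[of _ ?k ?k _ ?k _ ?k])
      thus ?thesis using transpose_mult_cancel(2)[OF U\<^sub>1(1) M] V(4) M by simp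
    qed
    hence "M = (U\<^sub>1 * bordered 1 U\<^sub>2) * mat_diag ?k (case_nat s d) * (V\<^sub>1 * bordered 1 V\<^sub>2)\<^sup>T"
      unfolding Bs using U(1,2) V(1,2) c
      by (simp add: transpose_mult[of _ ?k ?k _ ?k] assoc_mult_mat[of _ ?k ?k _ ?k _ ?k]
          mult_carrier_mat[of _ ?k ?k _ ?k])
    moreover have "U\<^sub>1 * bordered 1 U\<^sub>2 \<in> orthogonal_group ?k" "V\<^sub>1 * bordered 1 V\<^sub>2 \<in> orthogonal_group ?k"
      using UV2 U\<^sub>1 V\<^sub>1 by (auto intro: orthogonal_group_mult bordered_orthogonal)
    \<comment> \<open>a nonzero value is split off only from an invertible matrix, so no zero can follow it\<close>
    moreover have "r = 0" if "s \<noteq> 0"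
    proof (rule svd_det_nonzero[OF IH])
      have "det B = det U\<^sub>1 * det M * det V\<^sub>1"
        using U V M by (simp add: B_def det_mult[of _ ?k] det_transpose[of _ ?k])
      moreover have "det U\<^sub>1 * det U\<^sub>1 = 1" "det V\<^sub>1 * det V\<^sub>1 = 1"
        using arg_cong[OF U(4), of det] arg_cong[OF V(4), of det] U(1) V(1)
        by (auto simp: det_mult[of _ ?k] det_transpose[of _ ?k])
      ultimately have "det B \<noteq> 0" using that s(2) by auto
      thus "det C \<noteq> 0" using C by (simp add: det_bordered)
    qed
    ultimately have "svd ?k M (U\<^sub>1 * bordered 1 U\<^sub>2) (case_nat s d) (V\<^sub>1 * bordered 1 V\<^sub>2)
        (if s = 0 then Suc r else 0)"
      using d s unfolding svd_def by (auto split: nat.split)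
    thus ?case by blast
  qed
  thus thesis using that by blast
qed

section \<open>Positive semidefinite matrices and square roots\<close>

lemma CovD:
  assumes "A \<in> Cov k"
  shows "A \<in> carrier_mat k k" "A\<^sup>T = A" "\<And>v. v \<in> carrier_vec k \<Longrightarrow> 0 \<le> v \<bullet> (A *\<^sub>v v)"
  using assms by (auto simp: Cov_def)

lemma Cov_congruence:
  assumes A: "A \<in> Cov k" and B: "B \<in> carrier_mat k k"
  shows "B\<^sup>T * A * B \<in> Cov k"
proof -
  note A = CovD[OF A]
  have "0 \<le> v \<bullet> ((B\<^sup>T * A * B) *\<^sub>v v)" if v: "v \<in> carrier_vec k" for v
  proof -
    have "v \<bullet> ((B\<^sup>T * A * B) *\<^sub>v v) = v \<bullet> (B\<^sup>T *\<^sub>v (A *\<^sub>v (B *\<^sub>v v)))"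
      using A(1) B v by (simp add: assoc_mult_mat_vec[of _ k k _ k])
    also have "\<dots> = (B\<^sup>T *\<^sub>v (A *\<^sub>v (B *\<^sub>v v))) \<bullet> v"
      using A(1) B v by (intro comm_scalar_prod[of _ k]) (auto intro: mult_mat_vec_carrier)
    also have "\<dots> = (A *\<^sub>v (B *\<^sub>v v)) \<bullet> (B *\<^sub>v v)"
      by (rule transpose_vec_mult_scalar[OF B v]) (use A(1) B v in \<open>auto intro: mult_mat_vec_carrier\<close>)
    also have "\<dots> = (B *\<^sub>v v) \<bullet> (A *\<^sub>v (B *\<^sub>v v))"
      using A(1) B v by (intro comm_scalar_prod[of _ k]) (auto intro: mult_mat_vec_carrier)
    also have "0 \<le> \<dots>" using A(3)[of "B *\<^sub>v v"] B v by (auto intro: mult_mat_vec_carrier)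
    finally show ?thesis .
  qed
  thus ?thesis using A B
    by (auto simp: Cov_def transpose_mult[of _ k k _ k] assoc_mult_mat[of _ k k _ k _ k]
        mult_carrier_mat[of _ k k _ k])
qed

lemma mat_diag_transpose: "(mat_diag k d)\<^sup>T = mat_diag k d"
  by (rule eq_matI) (auto simp: mat_diag_def)

lemma mat_diag_mult_vec:
  "v \<in> carrier_vec k \<Longrightarrow> mat_diag k d *\<^sub>v v = vec k (\<lambda>i. d i * v $ i)"
  by (rule eq_vecI) (auto simp: mat_diag_def scalar_prod_def if_distrib[of "\<lambda>x. x * _"] cong: if_cong)

lemma scalar_prod_mat_diag:
  fixes v :: "real vec"
  assumes "v \<in> carrier_vec k"
  shows "v \<bullet> (mat_diag k d *\<^sub>v v) = (\<Sum>i<k. d i * (v $ i)\<^sup>2)"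
  using assms by (auto simp: mat_diag_mult_vec scalar_prod_def atLeast0LessThan power2_eq_square
      mult_ac intro!: sum.cong)

lemma mat_diag_Cov: "\<forall>i<k. 0 \<le> d i \<Longrightarrow> mat_diag k d \<in> Cov k"
  by (auto simp: Cov_def mat_diag_transpose scalar_prod_mat_diag intro!: sum_nonneg)

text \<open>Uniqueness of the positive semidefinite square root, for a diagonal square. Comparing entries, \<open>S\<close>
commutes with \<open>D\<^sup>2\<close> and therefore with \<open>D\<close>, so \<open>(S + D)(S - D) = 0\<close>. Thus \<open>w = (S - D) v\<close> satisfies
\<open>w \<bullet> S w + w \<bullet> D w = 0\<close>. Both terms are nonnegative; the second one is a sum of nonnegative
terms, so \<open>D w = 0\<close>, then \<open>S w = 0\<close>, and finally \<open>w \<bullet> w = v \<bullet> (S - D) w = 0\<close>.\<close>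

lemma Cov_square_eq_diag:
  assumes S: "S \<in> Cov k" and d: "\<forall>i<k. 0 \<le> (d i :: real)"
    and eq: "S * S = mat_diag k (\<lambda>i. d i * d i)"
  shows "S = mat_diag k d"
proof -
  let ?D = "mat_diag k d"
  note Sc = CovD[OF S]
  have "S * mat_diag k (\<lambda>i. d i * d i) = mat_diag k (\<lambda>i. d i * d i) * S"
    unfolding eq[symmetric] using Sc by (simp add: assoc_mult_mat[of _ k k _ k _ k]
        mult_carrier_mat[of _ k k _ k])
  hence "S $$ (i,j) * (d j * d j) = d i * d i * S $$ (i,j)" if "i < k" "j < k" for i j
    unfolding mat_diag_mult_right[OF Sc(1)] mat_diag_mult_left[OF Sc(1)]
    using that by (auto dest: arg_cong[of _ _ "\<lambda>A. A $$ (i,j)"])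
  hence "S $$ (i,j) * d j = d i * S $$ (i,j)" if "i < k" "j < k" for i j
    using that d by (metis abs_of_nonneg mult.commute mult_cancel_left power2_eq_square power2_eq_iff_nonneg)
  hence comm: "S * ?D = ?D * S"
    unfolding mat_diag_mult_right[OF Sc(1)] mat_diag_mult_left[OF Sc(1)]
    by (intro eq_matI) auto
  have zero: "(S - ?D) *\<^sub>v v = 0\<^sub>v k" if v: "v \<in> carrier_vec k" for v
  proof -
    define w where "w = (S - ?D) *\<^sub>v v"
    have SD: "S - ?D \<in> carrier_mat k k" by (intro minus_carrier_mat) simp
    have w: "w \<in> carrier_vec k" using v SD by (simp add: w_def)
    have "(S + ?D) * (S - ?D) = S * S + ?D * S - (S * ?D + ?D * ?D)"
      using Sc(1) SD
      by (simp add: add_mult_distrib_mat[of _ k k _ _ k] mult_minus_distrib_mat[of _ k k _ k])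
    also have "\<dots> = S * S + ?D * S - (?D * S + S * S)" using comm eq by simp
    also have "\<dots> = 0\<^sub>m k k"
      using Sc(1) by (intro eq_matI) (auto simp: mat_diag_def)
    finally have "(S + ?D) * (S - ?D) = 0\<^sub>m k k" .
    hence "(S + ?D) *\<^sub>v w = 0\<^sub>v k"
      using v SD Sc by (auto simp: w_def simp flip: assoc_mult_mat_vec[of _ k k _ k])
    hence sum0: "S *\<^sub>v w + ?D *\<^sub>v w = 0\<^sub>v k"
      using w Sc by (simp add: add_mult_distrib_mat_vec[of _ k k])
    have "w \<bullet> (S *\<^sub>v w) + w \<bullet> (?D *\<^sub>v w) = w \<bullet> (S *\<^sub>v w + ?D *\<^sub>v w)"
      using w Sc by (subst scalar_prod_add_distrib[of _ k]) (auto simp: mult_mat_vec_carrier[of _ k k])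
    also have "\<dots> = 0" using sum0 w by simp
    finally have "w \<bullet> (?D *\<^sub>v w) = 0"
      using Sc(3)[OF w] CovD(3)[OF mat_diag_Cov[OF d] w] by linarith
    hence "\<forall>i\<in>{..<k}. d i * (w $ i)\<^sup>2 = 0"
      unfolding scalar_prod_mat_diag[OF w] using d by (subst (asm) sum_nonneg_eq_0_iff) auto
    hence Dw: "?D *\<^sub>v w = 0\<^sub>v k" using w by (auto simp: mat_diag_mult_vec)
    hence "S *\<^sub>v w = 0\<^sub>v k" using sum0 Sc w
      by (metis mult_mat_vec_carrier right_zero_vec)
    hence "(S - ?D) *\<^sub>v w = 0\<^sub>v k"
      using Dw Sc w by (auto simp: minus_mult_distrib_mat_vec[of _ k k])
    moreover have "(S - ?D)\<^sup>T = S - ?D"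
      using Sc by (simp add: transpose_minus[of _ k k] mat_diag_transpose)
    ultimately have "w \<bullet> w = 0"
      using symmetric_mat_scalar_prod[OF SD _ v w] v by (simp add: w_def)
    thus ?thesis using scalar_prod_self_eq_0[OF w] by (simp add: w_def)
  qed
  show ?thesis
  proof (rule eq_matI)
    fix i j assume "i < dim_row ?D" "j < dim_col ?D"
    hence ij: "i < k" "j < k" by (auto simp: mat_diag_def)
    have "((S - ?D) *\<^sub>v unit_vec k j) $ i = 0" using zero[of "unit_vec k j"] ij by simp
    moreover have "S - ?D \<in> carrier_mat k k" by (intro minus_carrier_mat) simp
    ultimately have "(S - ?D) $$ (i,j) = 0" 
      using ij by (auto simp: mult_mat_vec_def carrier_matD[OF mat_diag_dim])
    thus "S $$ (i,j) = ?D $$ (i,j)" using ij Sc by (simp add: mat_diag_def)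
  qed (use Sc in \<open>auto simp: mat_diag_def\<close>)
qed

section \<open>The Bures--Wasserstein index set\<close>

definition block_identity :: "nat \<Rightarrow> nat \<Rightarrow> real mat \<Rightarrow> real mat" where
  "block_identity k r Q = four_block_mat Q (0\<^sub>m r (k - r)) (0\<^sub>m (k - r) r) (1\<^sub>m (k - r))"

lemma block_identity_orthogonal:
  assumes "r \<le> k" "Q \<in> orthogonal_group r"
  shows "block_identity k r Q \<in> orthogonal_group k"
proof (rule orthogonal_groupI)
  note Q = orthogonal_groupD[OF assms(2)]
  show "block_identity k r Q \<in> carrier_mat k k"
    using Q assms by (auto simp: block_identity_def)
  have "(block_identity k r Q)\<^sup>T * block_identity k r Q
      = four_block_mat (1\<^sub>m r) (0\<^sub>m r (k - r)) (0\<^sub>m (k - r) r) (1\<^sub>m (k - r))"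
    unfolding block_identity_def using Q
    by (subst transpose_four_block_mat[of _ r r _ "k - r" _ "k - r"], auto,
        subst mult_four_block_mat[of _ r r _ "k - r" _ "k - r" _ _ r _ "k - r"], auto)
  also have "\<dots> = 1\<^sub>m k" using assms by (intro eq_matI) auto
  finally show "(block_identity k r Q)\<^sup>T * block_identity k r Q = 1\<^sub>m k" .
qed

text \<open>If \<open>D W\<close> is symmetric, then \<open>(D W)\<^sup>2 = D W W\<^sup>T D = D\<^sup>2\<close>, so being positive
semidefinite forces \<open>D W = D\<close>. On the rows where \<open>D\<close> is nonzero \<open>W\<close> must then agree with the
identity, and orthogonality of its rows clears the rest of those columns. Nothing constrains the
block on the kernel of \<open>D\<close>.\<close>

lemma diag_mult_orthogonal_Cov_iff:
  assumes r: "r \<le> k" and d: "\<forall>i<k. 0 \<le> (d i :: real)" "\<forall>i<k. d i = 0 \<longleftrightarrow> i < r"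
    and W: "W \<in> orthogonal_group k"
  shows "mat_diag k d * W \<in> Cov k \<longleftrightarrow> (\<exists>Q\<in>orthogonal_group r. W = block_identity k r Q)"
proof
  note Wc = orthogonal_groupD[OF W]
  assume S: "mat_diag k d * W \<in> Cov k"
  let ?S = "mat_diag k d * W"
  have "?S * ?S = ?S * ?S\<^sup>T" using CovD(2)[OF S] by simp
  also have "\<dots> = mat_diag k d * (W * (W\<^sup>T * mat_diag k d))"
    using Wc(1,2) by (simp add: transpose_mult[of _ k k _ k] mat_diag_transpose assoc_mult_mat[of _ k k _ k _ k]
        mult_carrier_mat[of _ k k _ k])
  also have "\<dots> = mat_diag k (\<lambda>i. d i * d i)"
    by (simp add: transpose_mult_cancel(2)[OF W, of _ k])
  finally have "?S = mat_diag k d" by (rule Cov_square_eq_diag[OF S d(1)])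
  hence "d i * W $$ (i,j) = (if i = j then d i else 0)" if "i < k" "j < k" for i j
    using that unfolding mat_diag_mult_left[OF Wc(1)]
    by (auto simp: mat_diag_def dest: arg_cong[of _ _ "\<lambda>A. A $$ (i,j)"])
  \<comment> \<open>the rows belonging to nonzero diagonal entries\<close>
  hence low: "W $$ (i,j) = (if i = j then 1 else 0)" if "r \<le> i" "i < k" "j < k" for i j
    using that d(2) by (metis mult_cancel_left mult.right_neutral mult_zero_right not_le)
  \<comment> \<open>row i is orthogonal to row j, which is the unit vector with index j\<close>
  have up: "W $$ (i,j) = 0" if "i < r" "r \<le> j" "j < k" for i j
  proof -
    have "(\<Sum>l<k. W $$ (i,l) * W $$ (j,l)) = (W * W\<^sup>T) $$ (i,j)"
      using that r Wc(1) by (auto simp: scalar_prod_def atLeast0LessThan)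
    also have "\<dots> = 0" using that r by (simp add: Wc(4))
    also have "(\<Sum>l<k. W $$ (i,l) * W $$ (j,l)) = (\<Sum>l<k. if l = j then W $$ (i,j) else 0)"
      using that by (intro sum.cong) (auto simp: low)
    finally show ?thesis using that by simp
  qed
  define Q where "Q = mat r r (\<lambda>ij. W $$ ij)"
  have Q: "Q \<in> carrier_mat r r" by (simp add: Q_def)
  have WQ: "W = block_identity k r Q"
    using r Wc(1) by (intro eq_matI) (auto simp: block_identity_def Q_def low up)
  have "Q * Q\<^sup>T = 1\<^sub>m r"
  proof (rule eq_matI)
    fix i j assume ij: "i < dim_row (1\<^sub>m r :: real mat)" "j < dim_col (1\<^sub>m r :: real mat)"
    have "(Q * Q\<^sup>T) $$ (i,j) = (\<Sum>l<r. W $$ (i,l) * W $$ (j,l))"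
      using ij r Wc(1) by (auto simp: Q_def scalar_prod_def atLeast0LessThan)
    also have "\<dots> = (\<Sum>l<k. W $$ (i,l) * W $$ (j,l))"
      using r ij by (intro sum.mono_neutral_left) (auto simp: up)
    also have "\<dots> = (W * W\<^sup>T) $$ (i,j)"
      using ij r Wc(1) by (auto simp: scalar_prod_def atLeast0LessThan)
    finally show "(Q * Q\<^sup>T) $$ (i,j) = 1\<^sub>m r $$ (i,j)" using ij r by (simp add: Wc(4))
  qed (auto simp: Q_def)
  hence "Q\<^sup>T \<in> orthogonal_group r" using Q by (intro orthogonal_groupI) auto
  hence "Q \<in> orthogonal_group r" using orthogonal_group_transpose by fastforce
  thus "\<exists>Q\<in>orthogonal_group r. W = block_identity k r Q" using WQ by blast
next
  assume "\<exists>Q\<in>orthogonal_group r. W = block_identity k r Q"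
  then obtain Q where Q: "Q \<in> orthogonal_group r" "W = block_identity k r Q" by blast
  have "mat_diag k d * W = mat_diag k d"
    unfolding mat_diag_mult_left[OF orthogonal_groupD(1)[OF W]]
    using Q(2) orthogonal_groupD(1)[OF Q(1)] r d(2)
    by (intro eq_matI) (auto simp: block_identity_def mat_diag_def)
  thus "mat_diag k d * W \<in> Cov k" using mat_diag_Cov[OF d(1)] by simp
qed

text \<open>Substituting \<open>R = V W U\<^sup>T\<close> turns the matrix \<open>X\<^sup>T Y R\<close> into \<open>U (D W) U\<^sup>T\<close>, which is positive
semidefinite exactly if \<open>D W\<close> is.\<close>

lemma index_BW_svd:
  assumes svd: "svd k (X\<^sup>T * Y) U d V r"
  shows "index_BW k X Y = (\<lambda>Q. V * block_identity k r Q * U\<^sup>T) ` orthogonal_group r"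
proof -
  let ?D = "mat_diag k d"
  have U: "U \<in> orthogonal_group k" and V: "V \<in> orthogonal_group k" and r: "r \<le> k"
    and d: "\<forall>i<k. 0 \<le> d i" "\<forall>i<k. d i = 0 \<longleftrightarrow> i < r" and M: "X\<^sup>T * Y = U * ?D * V\<^sup>T"
    using svd by (auto simp: svd_def)
  note Uc = orthogonal_groupD[OF U] and Vc = orthogonal_groupD[OF V]
  have iff: "X\<^sup>T * Y * (V * W * U\<^sup>T) \<in> Cov k \<longleftrightarrow> ?D * W \<in> Cov k" (is "?R \<in> _ \<longleftrightarrow> _")
    if W: "W \<in> carrier_mat k k" for W
  proof -
    have "?R = U * (?D * (V\<^sup>T * (V * (W * U\<^sup>T))))"
      unfolding M using Uc(1,2) Vc(1,2) W by (simp add: assoc_mult_mat[of _ k k _ k _ k]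
        mult_carrier_mat[of _ k k _ k])
    also have "V\<^sup>T * (V * (W * U\<^sup>T)) = W * U\<^sup>T"
      by (rule transpose_mult_cancel[OF V]) (use W Uc in auto)
    finally have R: "?R = U * (?D * W) * U\<^sup>T"
      using Uc(1,2) W by (simp add: assoc_mult_mat[of _ k k _ k _ k]
        mult_carrier_mat[of _ k k _ k])
    have "U\<^sup>T * ?R * U = U\<^sup>T * (U * (?D * (W * (U\<^sup>T * U))))"
      unfolding R using Uc(1,2) W by (simp add: assoc_mult_mat[of _ k k _ k _ k]
        mult_carrier_mat[of _ k k _ k])
    hence "?D * W = U\<^sup>T * ?R * U"
      using transpose_mult_cancel(1)[OF U, of "?D * W" k] W Uc(3)
      by (simp add: mult_carrier_mat[of _ k k _ k])
    thus ?thesis using R Cov_congruence[of "?D * W" k "U\<^sup>T"] Cov_congruence[of ?R k U] Uc by auto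
  qed
  have block: "V * W * U\<^sup>T \<in> orthogonal_group k" if "W \<in> orthogonal_group k" for W
    using that U V by (intro orthogonal_group_mult orthogonal_group_transpose)
  show ?thesis
  proof (intro equalityI subsetI)
    fix R assume "R \<in> index_BW k X Y"
    hence R: "R \<in> orthogonal_group k" "X\<^sup>T * Y * R \<in> Cov k" by (auto simp: index_BW_def)
    define W where "W = V\<^sup>T * R * U"
    have W: "W \<in> orthogonal_group k"
      unfolding W_def using R U V by (intro orthogonal_group_mult orthogonal_group_transpose)
    have "V * W * U\<^sup>T = V * (V\<^sup>T * (R * (U * U\<^sup>T)))"
      unfolding W_def using Uc(1,2) Vc(1,2) orthogonal_groupD(1)[OF R(1)]
      by (simp add: assoc_mult_mat[of _ k k _ k _ k]
        mult_carrier_mat[of _ k k _ k])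
    also have "\<dots> = R"
      using transpose_mult_cancel(2)[OF V, of R k] orthogonal_groupD(1)[OF R(1)] Uc(4) by simp
    finally have RW: "R = V * W * U\<^sup>T" by simp
    hence "?D * W \<in> Cov k" using iff[of W] R(2) orthogonal_groupD(1)[OF W] by simp
    then obtain Q where "Q \<in> orthogonal_group r" "W = block_identity k r Q"
      using diag_mult_orthogonal_Cov_iff[OF r d W] by blast
    thus "R \<in> (\<lambda>Q. V * block_identity k r Q * U\<^sup>T) ` orthogonal_group r" using RW by blast
  next
    fix R assume "R \<in> (\<lambda>Q. V * block_identity k r Q * U\<^sup>T) ` orthogonal_group r"
    then obtain Q where Q: "Q \<in> orthogonal_group r" "R = V * block_identity k r Q * U\<^sup>T" by blast
    have W: "block_identity k r Q \<in> orthogonal_group k" by (rule block_identity_orthogonal[OF r Q(1)])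
    hence "X\<^sup>T * Y * R \<in> Cov k"
      using iff[OF orthogonal_groupD(1)[OF W]] diag_mult_orthogonal_Cov_iff[OF r d W] Q by blast
    thus "R \<in> index_BW k X Y" using block[OF W] Q(2) by (simp add: index_BW_def)
  qed
qed

section \<open>Invariance of the nullity\<close>

lemma det_nonzero_inverse:
  fixes A :: "real mat"
  assumes "A \<in> carrier_mat k k" "det A \<noteq> 0"
  obtains B where "B \<in> carrier_mat k k" "A * B = 1\<^sub>m k" "B * A = 1\<^sub>m k"
  using det_non_zero_imp_unit[OF assms, of undefined] by (auto simp: Units_def ring_mat_def)

text \<open>The first \<open>r\<close> columns of \<open>C\<close> live in the first \<open>r'\<close> coordinates and are linearly independent. For
\<open>r' < r\<close>, the corresponding corners of \<open>C\<close> and of its inverse, padded by zeros to size \<open>r\<close>, would be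
mutually inverse, but the padded corner of \<open>C\<close> has a zero row.\<close>

lemma invertible_zero_block:
  fixes C :: "real mat"
  assumes C: "C \<in> carrier_mat k k" "det C \<noteq> 0" and r: "r \<le> k"
    and zero: "\<And>i j. r' \<le> i \<Longrightarrow> i < k \<Longrightarrow> j < r \<Longrightarrow> C $$ (i,j) = 0"
  shows "r \<le> r'"
proof (rule ccontr)
  assume "\<not> r \<le> r'"
  hence r': "r' < r" by simp
  obtain B where B: "B \<in> carrier_mat k k" "B * C = 1\<^sub>m k"
    using det_nonzero_inverse[OF C] by blast
  define L where "L = mat r r (\<lambda>(i,j). if j < r' then B $$ (i,j) else 0)"
  define R where "R = mat r r (\<lambda>(i,j). if i < r' then C $$ (i,j) else 0)"
  have LR: "L \<in> carrier_mat r r" "R \<in> carrier_mat r r" by (auto simp: L_def R_def)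
  have "L * R = 1\<^sub>m r"
  proof (rule eq_matI)
    fix i j assume ij: "i < dim_row (1\<^sub>m r :: real mat)" "j < dim_col (1\<^sub>m r :: real mat)"
    have "(L * R) $$ (i,j) = (\<Sum>l<r. if l < r' then B $$ (i,l) * C $$ (l,j) else 0)"
      using ij by (auto simp: L_def R_def scalar_prod_def atLeast0LessThan intro!: sum.cong)
    also have "\<dots> = (\<Sum>l<k. B $$ (i,l) * C $$ (l,j))"
      using ij r r' by (intro sum.mono_neutral_cong_left) (auto simp: zero)
    also have "\<dots> = (B * C) $$ (i,j)"
      using ij r B(1) C(1) by (auto simp: scalar_prod_def atLeast0LessThan)
    finally show "(L * R) $$ (i,j) = 1\<^sub>m r $$ (i,j)" using ij r B by simp
  qed (use LR in auto)
  hence "R * L = 1\<^sub>m r" by (rule mat_mult_left_right_inverse[OF LR])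
  moreover have "(R * L) $$ (r',r') = 0"
    using r' LR by (auto simp: R_def L_def scalar_prod_def)
  ultimately show False using r' by simp
qed

text \<open>The injective map \<open>H\<close> sends the kernel of \<open>M\<close> into the kernel of \<open>N\<close>. In the coordinates given by
the right singular vectors, \<open>H\<close> becomes a matrix \<open>C\<close> with the zero block considered above.\<close>

lemma svd_nullity_le:
  assumes M: "svd k M U d V r" and N: "svd k N U' d' V' r'"
    and G: "G \<in> carrier_mat k k" and H: "H \<in> carrier_mat k k" "det H \<noteq> 0"
    and eq: "N * H = G * M"
  shows "r \<le> r'"
proof -
  have O: "U \<in> orthogonal_group k" "V \<in> orthogonal_group k"
    "U' \<in> orthogonal_group k" "V' \<in> orthogonal_group k"
    and r: "r \<le> k" and d: "\<forall>i<k. d i = 0 \<longleftrightarrow> i < r" "\<forall>i<k. d' i = 0 \<longleftrightarrow> i < r'"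
    and MN: "M = U * mat_diag k d * V\<^sup>T" "N = U' * mat_diag k d' * V'\<^sup>T"
    using M N by (auto simp: svd_def)
  note U = orthogonal_groupD[OF O(1)] and V = orthogonal_groupD[OF O(2)]
    and U' = orthogonal_groupD[OF O(3)] and V' = orthogonal_groupD[OF O(4)]
  note assoc = assoc_mult_mat[of _ k k _ k _ k] and closed = mult_carrier_mat[of _ k k _ k]
  define C where "C = V'\<^sup>T * H * V"
  define E where "E = U'\<^sup>T * G * U"
  have CE: "C \<in> carrier_mat k k" "E \<in> carrier_mat k k"
    using U U' V V' G H by (auto simp: C_def E_def)
  have "mat_diag k d' * C = U'\<^sup>T * (U' * (mat_diag k d' * C))"
    by (rule transpose_mult_cancel(1)[OF O(3), of _ k, symmetric]) (use CE in \<open>auto intro!: closed\<close>)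
  also have "\<dots> = U'\<^sup>T * (N * H) * V"
    unfolding MN C_def using U'(1,2) V(1) V'(1,2) H by (simp add: assoc closed)
  also have "\<dots> = U'\<^sup>T * (G * (U * (mat_diag k d * (V\<^sup>T * V))))"
    unfolding eq unfolding MN(1) using U'(1,2) U(1,2) V(1,2) G by (simp add: assoc closed)
  also have "\<dots> = E * mat_diag k d"
    unfolding E_def V(3) using U(1,2) U'(1,2) G
    by (simp add: assoc closed right_mult_one_mat[of "mat_diag k d" k k])
  finally have eqC: "mat_diag k d' * C = E * mat_diag k d" .
  have "d' i * C $$ (i,j) = E $$ (i,j) * d j" if "i < k" "j < k" for i j
    using eqC that unfolding mat_diag_mult_left[OF CE(1)] mat_diag_mult_right[OF CE(2)]
    by (auto dest: arg_cong[of _ _ "\<lambda>A. A $$ (i,j)"])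
  hence zero: "C $$ (i,j) = 0" if "r' \<le> i" "i < k" "j < r" for i j
    using that d r by (metis mult_eq_0_iff not_le order_less_le_trans)
  have "det V \<noteq> 0" "det V' \<noteq> 0"
    using arg_cong[OF V(4), of det] arg_cong[OF V'(4), of det] V(1,2) V'(1,2)
    by (auto simp: det_mult[of _ k])
  hence "det C \<noteq> 0"
    using V V' H by (simp add: C_def det_mult[of _ k] det_transpose[of _ k])
  thus ?thesis using invertible_zero_block[OF CE(1) _ r zero] by blast
qed

section \<open>Singular values\<close>

text \<open>The matrix \<open>M\<^sup>T M = V D\<^sup>2 V\<^sup>T\<close> is similar to \<open>D\<^sup>2\<close>, so both have the same characteristic polynomial.\<close>

lemma singular_values_svd:
  assumes "svd k M U d V r"
  shows "singular_values M = mset (map d [0..<k])"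
proof -
  let ?D = "mat_diag k d" and ?D2 = "mat_diag k (\<lambda>i. d i * d i)"
  have O: "U \<in> orthogonal_group k" "V \<in> orthogonal_group k" and d: "\<forall>i<k. 0 \<le> d i"
    and M: "M = U * ?D * V\<^sup>T"
    using assms by (auto simp: svd_def)
  note U = orthogonal_groupD[OF O(1)] and V = orthogonal_groupD[OF O(2)]
  note assoc = assoc_mult_mat[of _ k k _ k _ k] and closed = mult_carrier_mat[of _ k k _ k]
  have "M\<^sup>T * M = V * (?D * (U\<^sup>T * (U * (?D * V\<^sup>T))))"
    unfolding M using U(1,2) V(1,2)
    by (simp add: transpose_mult[of _ k k _ k] mat_diag_transpose assoc closed)
  also have "U\<^sup>T * (U * (?D * V\<^sup>T)) = ?D * V\<^sup>T"
    by (rule transpose_mult_cancel(1)[OF O(1), of _ k]) (use V(1,2) in \<open>auto intro!: closed\<close>)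
  also have "V * (?D * (?D * V\<^sup>T)) = V * (?D * ?D) * V\<^sup>T"
    using V(1,2) by (simp add: assoc closed del: mat_diag_diag)
  finally have MM: "M\<^sup>T * M = V * ?D2 * V\<^sup>T" by simp
  hence "similar_mat (M\<^sup>T * M) ?D2"
    using V by (intro similar_matI[of _ _ V "V\<^sup>T" k]) (auto simp: closed)
  hence "char_poly (M\<^sup>T * M) = char_poly ?D2" by (rule char_poly_similar)
  also have "\<dots> = (\<Prod>a\<leftarrow>diag_mat ?D2. [:- a, 1:])"
    by (rule char_poly_upper_triangular[of _ k]) (auto simp: mat_diag_def)
  also have "diag_mat ?D2 = map (\<lambda>i. d i * d i) [0..<k]"
    by (auto simp: diag_mat_def mat_diag_def)
  finally have cp: "char_poly (M\<^sup>T * M) = (\<Prod>a\<leftarrow>map (\<lambda>i. d i * d i) [0..<k]. [:- a, 1:])" .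
  have "proots (\<Prod>a\<leftarrow>as. [:- a, 1:]) = mset as" for as :: "real list"
  proof (induction as)
    case (Cons a as)
    have "(\<Prod>a\<leftarrow>as. [:- a, 1:]) \<noteq> 0" by (auto simp: prod_list_zero_iff)
    thus ?case using Cons by (simp add: proots_mult del: mult_pCons_left)
  qed simp
  hence "proots (char_poly (M\<^sup>T * M)) = mset (map (\<lambda>i. d i * d i) [0..<k])" unfolding cp .
  hence "singular_values M = mset (map sqrt (map (\<lambda>i. d i * d i) [0..<k]))"
    unfolding singular_values_def by (simp only: mset_map)
  also have "map sqrt (map (\<lambda>i. d i * d i) [0..<k]) = map d [0..<k]" using d by auto
  finally show ?thesis .
qed

section \<open>Column spaces and orthonormal bases\<close>

text \<open>A kernel vector of \<open>X\<^sup>T X\<close> is a kernel vector of \<open>X\<close>, because \<open>v \<bullet> X\<^sup>T X v\<close> is the squared length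
of \<open>X v\<close>. Linear (in)dependence is phrased for the set of columns, so the columns also have to be
distinct; this is another consequence of the rank being \<open>k\<close>.\<close>

lemma full_rank_gram_det:
  assumes X: "X \<in> carrier_mat n k" and rank: "vec_space.rank n X = k"
  shows "det (X\<^sup>T * (X :: real mat)) \<noteq> 0"
proof
  interpret vec_space "TYPE(real)" n .
  have XX: "X\<^sup>T * X \<in> carrier_mat k k" using X by simp
  assume "det (X\<^sup>T * X) = 0"
  then obtain v where v: "v \<in> carrier_vec k" "v \<noteq> 0\<^sub>v k" "(X\<^sup>T * X) *\<^sub>v v = 0\<^sub>v k"
    using det_0_iff_vec_prod_zero_field[OF XX] by blast
  have Xv: "X *\<^sub>v v \<in> carrier_vec n" using X v by simp
  have "(X *\<^sub>v v) \<bullet> (X *\<^sub>v v) = (X\<^sup>T *\<^sub>v (X *\<^sub>v v)) \<bullet> v"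
    by (rule transpose_vec_mult_scalar[symmetric, OF X v(1) Xv])
  also have "X\<^sup>T *\<^sub>v (X *\<^sub>v v) = 0\<^sub>v k"
    using v X by (simp add: assoc_mult_mat_vec[of _ k n _ k])
  finally have "X *\<^sub>v v = 0\<^sub>v n" using scalar_prod_self_eq_0[OF Xv] v(1) by simp
  have dist: "distinct (cols X)"
  proof -
    obtain S where S: "maximal S (\<lambda>T. T \<subseteq> set (cols X) \<and> lin_indpt T)"
      using maximal_exists_superset[of "set (cols X)" "\<lambda>T. T \<subseteq> set (cols X) \<and> lin_indpt T" "{}"]
        finite_lin_indpt2[of "{}"] by auto
    hence "card S = k" using rank_card_indpt[OF X] rank by simp
    moreover have "card S \<le> card (set (cols X))"
      using S by (intro card_mono) (auto simp: maximal_def)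
    ultimately have "card (set (cols X)) = length (cols X)"
      using X card_length[of "cols X"] by simp
    thus ?thesis by (rule card_distinct)
  qed
  show False
    using lin_depI[OF X v(1,2) \<open>X *\<^sub>v v = 0\<^sub>v n\<close> dist] full_rank_lin_indpt[OF X rank dist] by simp
qed

lemma col_space_image:
  assumes "(A :: real mat) \<in> carrier_mat n k"
  shows "vec_space.col_space n A = (\<lambda>v. A *\<^sub>v v) ` carrier_vec k"
  using vec_space.col_space_eq[OF assms] assms by (auto simp: mult_mat_vec_carrier[of _ n k])

lemma col_space_mult_subset:
  assumes "(A :: real mat) \<in> carrier_mat n k" "B \<in> carrier_mat k l"
  shows "vec_space.col_space n (A * B) \<subseteq> vec_space.col_space n A"
  using assms by (auto simp: col_space_image[of _ n k] col_space_image[of _ n l]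
      assoc_mult_mat_vec[of _ n k _ l] intro!: imageI mult_mat_vec_carrier[of _ k l])

lemma col_space_factor:
  assumes A: "(A :: real mat) \<in> carrier_mat n k" and B: "B \<in> carrier_mat n l"
    and sub: "vec_space.col_space n B \<subseteq> vec_space.col_space n A"
  obtains G where "G \<in> carrier_mat k l" "B = A * G"
proof -
  have "\<exists>g. g \<in> carrier_vec k \<and> A *\<^sub>v g = col B j" if j: "j < l" for j
  proof -
    have "col B j = B *\<^sub>v unit_vec l j" using B j by (intro eq_vecI) auto
    hence "col B j \<in> vec_space.col_space n B" using B by (auto simp: col_space_image[of _ n l])
    thus ?thesis using sub A by (fastforce simp: col_space_image[of _ n k])
  qed
  then obtain g where g: "\<And>j. j < l \<Longrightarrow> g j \<in> carrier_vec k \<and> A *\<^sub>v g j = col B j" by metis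
  define G where "G = mat_of_cols k (map g [0..<l])"
  have G: "G \<in> carrier_mat k l" by (auto simp: G_def)
  have colG: "col G j = g j" if "j < l" for j using that g by (auto simp: G_def)
  have "B = A * G"
  proof (rule mat_col_eqI)
    fix j assume "j < dim_col (A * G)"
    hence j: "j < l" using G by simp
    show "col B j = col (A * G) j" 
      unfolding col_mult2[OF A G j] colG[OF j] using g[OF j] by (elim conjE) (rule sym)
  qed (use A B G in auto)
  thus thesis using that G by blast
qed

lemma StiefelD:
  assumes "Q \<in> Stiefel n k"
  shows "Q \<in> carrier_mat n k" "Q\<^sup>T \<in> carrier_mat k n" "Q\<^sup>T * Q = 1\<^sub>m k"
  using assms by (auto simp: Stiefel_def)

lemma gram_mult:
  assumes "(X :: real mat) \<in> carrier_mat n k" "G \<in> carrier_mat k l"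
    "Y \<in> carrier_mat n p" "H \<in> carrier_mat p q"
  shows "(X * G)\<^sup>T * (Y * H) = G\<^sup>T * (X\<^sup>T * Y) * H"
  using assms by (simp add: transpose_mult[of _ n k _ l] assoc_mult_mat[of _ l k _ n _ q]
      assoc_mult_mat[of _ k n _ p _ q] assoc_mult_mat[of _ l k _ p _ q] mult_carrier_mat[of _ n p _ q]
      mult_carrier_mat[of _ k n _ p])

lemma Stiefel_mult:
  assumes "Q \<in> Stiefel n k" "P \<in> orthogonal_group k"
  shows "Q * P \<in> Stiefel n k"
  using StiefelD[OF assms(1)] orthogonal_groupD[OF assms(2)]
  by (auto simp: Stiefel_def gram_mult[of _ n k _ k _ k _ k])

lemma Stiefel_same_col_space:
  assumes Q: "Q \<in> Stiefel n k" and Q': "Q' \<in> Stiefel n k"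
    and eq: "vec_space.col_space n Q' = vec_space.col_space n Q"
  obtains P where "P \<in> orthogonal_group k" "Q' = Q * P"
proof -
  note c = StiefelD[OF Q] StiefelD[OF Q']
  obtain P where P: "P \<in> carrier_mat k k" "Q' = Q * P"
    using col_space_factor[OF c(1) c(4)] eq by blast
  have "P\<^sup>T * P = Q'\<^sup>T * Q'"
    unfolding P(2) gram_mult[OF c(1) P(1) c(1) P(1)] using c P(1) by simp
  hence "P \<in> orthogonal_group k" using P c by (intro orthogonal_groupI) auto
  thus thesis using that P by blast
qed

text \<open>The positive definite matrix \<open>A = X\<^sup>T X\<close> has a singular value decomposition \<open>A = U D V\<^sup>T\<close>. The square
of \<open>U\<^sup>T A U\<close> is \<open>D\<^sup>2\<close>, so uniqueness of square roots gives \<open>U\<^sup>T A U = D\<close>, the spectral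
decomposition. Then \<open>H = U E\<close>, with \<open>E\<close> the inverse square root of \<open>D\<close>, makes the columns
of \<open>X H\<close> orthonormal.\<close>

lemma orthonormalize:
  fixes X :: "real mat"
  assumes X: "X \<in> carrier_mat n k" and det: "det (X\<^sup>T * X) \<noteq> 0"
  obtains H where "H \<in> carrier_mat k k" "det H \<noteq> 0" "X * H \<in> Stiefel n k"
proof -
  define A where "A = X\<^sup>T * X"
  have A: "A \<in> carrier_mat k k" "A\<^sup>T = A"
    using X by (auto simp: A_def transpose_mult[of _ k n _ k])
  have "A \<in> Cov k"
  proof -
    have "0 \<le> v \<bullet> (A *\<^sub>v v)" if v: "v \<in> carrier_vec k" for v
    proof -
      have "v \<bullet> (A *\<^sub>v v) = (X\<^sup>T *\<^sub>v (X *\<^sub>v v)) \<bullet> v"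
        using X v by (simp add: A_def assoc_mult_mat_vec[of _ k n _ k])
          (intro comm_scalar_prod[of _ k], auto intro!: mult_mat_vec_carrier[of _ k n] mult_mat_vec_carrier[of _ n k])
      also have "\<dots> = (X *\<^sub>v v) \<bullet> (X *\<^sub>v v)"
        by (rule transpose_vec_mult_scalar[OF X v]) (use X v in \<open>auto intro!: mult_mat_vec_carrier[of _ n k]\<close>)
      finally show ?thesis using scalar_prod_self_nonneg by simp
    qed
    thus ?thesis using A by (auto simp: Cov_def)
  qed
  obtain U d V r where svd: "svd k A U d V r" using svd_exists[OF A(1)] .
  have "r = 0" using svd_det_nonzero[OF svd] det by (simp add: A_def)
  hence O: "U \<in> orthogonal_group k" "V \<in> orthogonal_group k" and d: "\<forall>i<k. 0 < d i"
    and AUDV: "A = U * mat_diag k d * V\<^sup>T"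
    using svd by (auto simp: svd_def intro: le_neq_trans)
  note U = orthogonal_groupD[OF O(1)] and V = orthogonal_groupD[OF O(2)]
  note assoc = assoc_mult_mat[of _ k k _ k _ k] and closed = mult_carrier_mat[of _ k k _ k]
  let ?D = "mat_diag k d"
  define S where "S = U\<^sup>T * A * U"
  have S: "S \<in> Cov k" unfolding S_def by (rule Cov_congruence[OF \<open>A \<in> Cov k\<close> U(1)])
  have "S = ?D"
  proof (rule Cov_square_eq_diag[OF S])
    have S': "S = ?D * (V\<^sup>T * U)"
    proof -
      have "S = U\<^sup>T * (U * (?D * (V\<^sup>T * U)))"
        unfolding S_def AUDV using U(1,2) V(1,2) by (simp add: assoc closed)
      thus ?thesis using transpose_mult_cancel(1)[OF O(1), of "?D * (V\<^sup>T * U)" k] U V by (simp add: closed)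
    qed
    have W: "V\<^sup>T * U \<in> orthogonal_group k" using O by (intro orthogonal_group_mult orthogonal_group_transpose)
    note Wc = orthogonal_groupD[OF W]
    have "S * S = S * S\<^sup>T" using CovD[OF S] by simp
    also have "\<dots> = ?D * ((V\<^sup>T * U) * ((V\<^sup>T * U)\<^sup>T * ?D))"
      unfolding S' transpose_mult[OF mat_diag_dim Wc(1)] mat_diag_transpose
      by (rule assoc_mult_mat[of _ k k _ k _ k]) (use Wc(1,2) in \<open>auto intro!: closed\<close>)
    also have "\<dots> = mat_diag k (\<lambda>i. d i * d i)"
      using transpose_mult_cancel(2)[OF W, of ?D k] by simp
    finally show "S * S = mat_diag k (\<lambda>i. d i * d i)" .
  qed (use d in \<open>auto intro: less_imp_le\<close>)
  define E where "E = mat_diag k (\<lambda>i. 1 / sqrt (d i))"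
  have E: "E \<in> carrier_mat k k" "E\<^sup>T = E" by (auto simp: E_def mat_diag_transpose)
  define H where "H = U * E"
  have H: "H \<in> carrier_mat k k" using U E by (simp add: H_def)
  have "H\<^sup>T * A * H = E * S * E"
    unfolding H_def S_def using U(1,2) E A(1)
    by (simp add: transpose_mult[of _ k k _ k] assoc closed)
  also have "\<dots> = mat_diag k (\<lambda>i. 1 / sqrt (d i) * d i * (1 / sqrt (d i)))"
    by (simp add: \<open>S = ?D\<close> E_def)
  also have "\<dots> = 1\<^sub>m k" using d by (intro eq_matI) (auto simp: mat_diag_def)
  finally have HAH: "H\<^sup>T * A * H = 1\<^sub>m k" .
  have "det H \<noteq> 0"
    using arg_cong[OF HAH, of det] H A(1) by (auto simp: det_mult[of _ k])
  moreover have "X * H \<in> Stiefel n k"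
    using X H HAH by (auto simp: Stiefel_def A_def gram_mult[OF X H X H])
  ultimately show thesis using that H by blast
qed

section \<open>Principal angles\<close>

text \<open>The singular value \<open>d i\<close> is the inner product of the unit vectors \<open>Q\<^sub>1 U e\<^sub>i\<close> and \<open>Q\<^sub>2 V e\<^sub>i\<close>, so the
squared length of their difference is \<open>2 - 2 d i\<close>. The bound makes \<open>d i\<close> the cosine of an angle.\<close>

lemma svd_Stiefel_le_1:
  assumes Q: "Q\<^sub>1 \<in> Stiefel n k" "Q\<^sub>2 \<in> Stiefel n k" and svd: "svd k (Q\<^sub>1\<^sup>T * Q\<^sub>2) U d V r" and i: "i < k"
  shows "d i \<le> 1"
proof -
  have O: "U \<in> orthogonal_group k" "V \<in> orthogonal_group k" and M: "Q\<^sub>1\<^sup>T * Q\<^sub>2 = U * mat_diag k d * V\<^sup>T"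
    using svd by (auto simp: svd_def)
  note U = orthogonal_groupD[OF O(1)] and V = orthogonal_groupD[OF O(2)]
  note A = StiefelD[OF Stiefel_mult[OF Q(1) O(1)]] and B = StiefelD[OF Stiefel_mult[OF Q(2) O(2)]]
  have "(Q\<^sub>1 * U)\<^sup>T * (Q\<^sub>2 * V) = U\<^sup>T * (U * (mat_diag k d * (V\<^sup>T * V)))"
    unfolding gram_mult[OF StiefelD(1)[OF Q(1)] U(1) StiefelD(1)[OF Q(2)] V(1)] M
    using U(1,2) V(1,2) by (simp add: assoc_mult_mat[of _ k k _ k _ k] mult_carrier_mat[of _ k k _ k])
  also have "\<dots> = mat_diag k d"
    using transpose_mult_cancel(1)[OF O(1), of "mat_diag k d" k]
    by (simp add: V(3) right_mult_one_mat[of "mat_diag k d" k k])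
  finally have AB: "(Q\<^sub>1 * U)\<^sup>T * (Q\<^sub>2 * V) = mat_diag k d" .
  have entry: "col F i \<bullet> col G i = (F\<^sup>T * G) $$ (i,i)"
    if "F \<in> carrier_mat n k" "G \<in> carrier_mat n k" for F G :: "real mat"
    using that i by simp
  define a b where "a = col (Q\<^sub>1 * U) i" and "b = col (Q\<^sub>2 * V) i"
  have ab: "a \<in> carrier_vec n" "b \<in> carrier_vec n"
    unfolding a_def b_def using A(1) B(1) i by (auto intro!: col_carrier_vec)
  have aa: "a \<bullet> a = 1" "b \<bullet> b = 1" "a \<bullet> b = d i"
    unfolding a_def b_def entry[OF A(1) A(1)] entry[OF B(1) B(1)] entry[OF A(1) B(1)] A(3) B(3) AB
    using i by (simp_all add: mat_diag_def)
  have "b \<bullet> a = d i" using comm_scalar_prod[OF ab] aa(3) by simp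
  hence "(a - b) \<bullet> (a - b) = 2 - 2 * d i"
    using ab aa by (simp add: minus_scalar_prod_distrib[of _ n] scalar_prod_minus_distrib[of _ n])
  thus ?thesis using scalar_prod_self_nonneg[of "a - b"] by simp
qed

text \<open>Other orthonormal bases of the two subspaces are \<open>Q\<^sub>1 A\<close> and \<open>Q\<^sub>2 B\<close> with orthogonal \<open>A\<close> and \<open>B\<close>. They change
\<open>U\<close> and \<open>V\<close> into \<open>A\<^sup>T U\<close> and \<open>B\<^sup>T V\<close> but keep the singular values, and the angles in \<open>[0, \<pi>/2]\<close>
are recovered from their cosines. So the definite description in the definition of the angles
is proper.\<close>

lemma principal_angles_svd:
  assumes Q: "Q\<^sub>1 \<in> Stiefel n k" "Q\<^sub>2 \<in> Stiefel n k" and svd: "svd k (Q\<^sub>1\<^sup>T * Q\<^sub>2) U d V r"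
  shows "principal_angles n k (vec_space.col_space n Q\<^sub>1) (vec_space.col_space n Q\<^sub>2)
    = sort (map (\<lambda>i. arccos (d i)) [0..<k])" (is "principal_angles n k ?P\<^sub>1 ?P\<^sub>2 = ?\<theta>")
  unfolding principal_angles_def
proof (rule the_equality)
  have d: "0 \<le> d i" "d i \<le> 1" if "i < k" for i
    using svd svd_Stiefel_le_1[OF Q svd that] that by (auto simp: svd_def)
  have "mset (map cos ?\<theta>) = mset (map (\<lambda>i. cos (arccos (d i))) [0..<k])"
    by (simp add: multiset.map_comp comp_def)
  also have "map (\<lambda>i. cos (arccos (d i))) [0..<k] = map d [0..<k]"
  proof (rule map_cong[OF refl])
    fix i assume "i \<in> set [0..<k]"
    hence "0 \<le> d i" "d i \<le> 1" using d by simp_all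
    thus "cos (arccos (d i)) = d i" by (intro cos_arccos) linarith+
  qed
  finally have "singular_values (Q\<^sub>1\<^sup>T * Q\<^sub>2) = mset (map cos ?\<theta>)"
    using singular_values_svd[OF svd] by simp
  moreover have "set ?\<theta> \<subseteq> {0..pi/2}"
  proof
    fix t assume "t \<in> set ?\<theta>"
    then obtain i where i: "i < k" "t = arccos (d i)" by auto
    hence "0 \<le> d i" "d i \<le> 1" using d by simp_all
    thus "t \<in> {0..pi/2}" using arccos_lbound[of "d i"] arccos_le_pi2[of "d i"] i(2) by simp
  qed
  ultimately show "is_principal_angles n k ?P\<^sub>1 ?P\<^sub>2 ?\<theta>"
    using Q unfolding is_principal_angles_def by auto
next
  fix \<theta> assume "is_principal_angles n k ?P\<^sub>1 ?P\<^sub>2 \<theta>"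
  then obtain Q\<^sub>1' Q\<^sub>2' where \<theta>: "sorted \<theta>" "set \<theta> \<subseteq> {0..pi/2}"
    and Q': "Q\<^sub>1' \<in> Stiefel n k" "Q\<^sub>2' \<in> Stiefel n k"
      "vec_space.col_space n Q\<^sub>1' = ?P\<^sub>1" "vec_space.col_space n Q\<^sub>2' = ?P\<^sub>2"
      "singular_values (Q\<^sub>1'\<^sup>T * Q\<^sub>2') = mset (map cos \<theta>)"
    unfolding is_principal_angles_def by blast
  obtain A where A: "A \<in> orthogonal_group k" "Q\<^sub>1' = Q\<^sub>1 * A"
    using Stiefel_same_col_space[OF Q(1) Q'(1,3)] .
  obtain B where B: "B \<in> orthogonal_group k" "Q\<^sub>2' = Q\<^sub>2 * B"
    using Stiefel_same_col_space[OF Q(2) Q'(2,4)] .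
  have O: "U \<in> orthogonal_group k" "V \<in> orthogonal_group k" and M: "Q\<^sub>1\<^sup>T * Q\<^sub>2 = U * mat_diag k d * V\<^sup>T"
    using svd by (auto simp: svd_def)
  have "Q\<^sub>1'\<^sup>T * Q\<^sub>2' = (A\<^sup>T * U) * mat_diag k d * (B\<^sup>T * V)\<^sup>T"
    unfolding A(2) B(2)
      gram_mult[OF StiefelD(1)[OF Q(1)] orthogonal_groupD(1)[OF A(1)]
        StiefelD(1)[OF Q(2)] orthogonal_groupD(1)[OF B(1)]] M
    using orthogonal_groupD(1,2)[OF A(1)] orthogonal_groupD(1,2)[OF B(1)]
      orthogonal_groupD(1,2)[OF O(1)] orthogonal_groupD(1,2)[OF O(2)]
    by (simp add: transpose_mult[of _ k k _ k] assoc_mult_mat[of _ k k _ k _ k]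
        mult_carrier_mat[of _ k k _ k])
  hence "svd k (Q\<^sub>1'\<^sup>T * Q\<^sub>2') (A\<^sup>T * U) d (B\<^sup>T * V) r"
    using svd A(1) B(1) by (auto simp: svd_def intro!: orthogonal_group_mult orthogonal_group_transpose)
  hence "mset (map cos \<theta>) = mset (map d [0..<k])"
    using singular_values_svd Q'(5) by simp
  hence "mset (map arccos (map cos \<theta>)) = mset (map arccos (map d [0..<k]))"
    by (simp only: mset_map)
  moreover have "map arccos (map cos \<theta>) = \<theta>"
    unfolding map_map
  proof (rule map_idI)
    fix t assume "t \<in> set \<theta>"
    hence "0 \<le> t" "t \<le> pi / 2" using \<theta>(2) by auto
    hence "0 \<le> t" "t \<le> pi" using pi_ge_zero by linarith+
    thus "(arccos \<circ> cos) t = t" by (simp add: arccos_cos)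
  qed
  ultimately have "mset \<theta> = mset (map arccos (map d [0..<k]))" by (simp only:)
  hence "mset \<theta> = mset (map (\<lambda>i. arccos (d i)) [0..<k])" by (simp only: map_map comp_def)
  from properties_for_sort[OF this \<theta>(1)] show "\<theta> = ?\<theta>" by (rule sym)
qed

lemma num_right_angles_svd:
  assumes Q: "Q\<^sub>1 \<in> Stiefel n k" "Q\<^sub>2 \<in> Stiefel n k" and svd: "svd k (Q\<^sub>1\<^sup>T * Q\<^sub>2) U d V r"
  shows "num_right_angles n k (vec_space.col_space n Q\<^sub>1) (vec_space.col_space n Q\<^sub>2) = r"
proof -
  let ?xs = "map (\<lambda>i. arccos (d i)) [0..<k]"
  have right: "arccos (d i) = pi / 2 \<longleftrightarrow> i < r" if "i < k" for i
  proof -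
    have "\<bar>d i\<bar> \<le> 1" "d i = 0 \<longleftrightarrow> i < r"
      using svd svd_Stiefel_le_1[OF Q svd that] that by (auto simp: svd_def)
    moreover have "arccos (d i) = pi / 2 \<longleftrightarrow> d i = 0"
      using calculation(1) by (metis arccos_0 cos_arccos_abs abs_zero zero_le_one)
    ultimately show ?thesis by simp
  qed
  have "num_right_angles n k (vec_space.col_space n Q\<^sub>1) (vec_space.col_space n Q\<^sub>2)
      = length (filter (\<lambda>t. t = pi/2) (sort ?xs))"
    unfolding num_right_angles_def principal_angles_svd[OF Q svd] length_filter_conv_card by simp
  also have "\<dots> = length (filter (\<lambda>t. t = pi/2) ?xs)"
    by (simp only: filter_sort length_sort)
  also have "\<dots> = card {i. i < k \<and> arccos (d i) = pi/2}"
    unfolding length_filter_conv_card by (intro arg_cong[of _ _ card]) auto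
  also have "{i. i < k \<and> arccos (d i) = pi/2} = {..<r}"
    using right svd by (auto simp: svd_def)
  finally show ?thesis by simp
qed

text \<open>Since \<open>X = X X\<^sup>T (X K)\<close> for \<open>K\<close> the inverse of \<open>X\<^sup>T X\<close>, the matrices \<open>X\<close> and \<open>X X\<^sup>T\<close> have the same
column space. So the subspaces given by \<open>\<Sigma>\<^sub>1\<close> and \<open>\<Sigma>\<^sub>2\<close> can be described through \<open>X\<close> and \<open>Y\<close>.\<close>

lemma Stiefel_factorization:
  fixes X :: "real mat"
  assumes X: "X \<in> carrier_mat n k" and rank: "vec_space.rank n X = k"
  obtains Q G where "Q \<in> Stiefel n k"
    "vec_space.col_space n Q = vec_space.col_space n (X * X\<^sup>T)"
    "G \<in> carrier_mat k k" "det G \<noteq> 0" "X = Q * G"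
proof -
  have XT: "X\<^sup>T \<in> carrier_mat k n" and XX: "X\<^sup>T * X \<in> carrier_mat k k" using X by auto
  have det: "det (X\<^sup>T * X) \<noteq> 0" by (rule full_rank_gram_det[OF X rank])
  obtain H where H: "H \<in> carrier_mat k k" "det H \<noteq> 0" "X * H \<in> Stiefel n k"
    using orthonormalize[OF X det] .
  obtain G where G: "G \<in> carrier_mat k k" "H * G = 1\<^sub>m k" using det_nonzero_inverse[OF H(1,2)] by blast
  obtain K where K: "K \<in> carrier_mat k k" "X\<^sup>T * X * K = 1\<^sub>m k" using det_nonzero_inverse[OF XX det] by blast
  have XHG: "X = X * H * G" using X H(1) G by (simp add: assoc_mult_mat[of _ n k _ k _ k])
  have "X * X\<^sup>T * (X * K) = X * (X\<^sup>T * X * K)"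
    using X XT K(1) by (simp add: assoc_mult_mat[of _ n k _ n _ k] assoc_mult_mat[of _ k n _ k _ k]
        mult_carrier_mat[of _ n k _ k])
  hence X2: "X = X * X\<^sup>T * (X * K)" using K(2) X by simp
  have "vec_space.col_space n (X * H) = vec_space.col_space n X"
    using col_space_mult_subset[OF X H(1)] col_space_mult_subset[of "X * H" n k G k] XHG X H(1) G(1)
    by (auto simp: mult_carrier_mat[of _ n k _ k])
  moreover have "vec_space.col_space n (X * X\<^sup>T) = vec_space.col_space n X"
    using col_space_mult_subset[OF X XT] col_space_mult_subset[of "X * X\<^sup>T" n n "X * K" k] X2 X XT K(1)
    by (auto simp: mult_carrier_mat[of _ n k _ n] mult_carrier_mat[of _ n k _ k])
  moreover have "det G \<noteq> 0"
    using arg_cong[OF G(2), of det] H(1) G(1) by (auto simp: det_mult[of _ k])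
  ultimately show thesis using that[OF H(3) _ G(1)] XHG by simp
qed

section \<open>The bijection\<close>

theorem corollary2:
  fixes n k :: nat and \<Sigma>\<^sub>1 \<Sigma>\<^sub>2 X Y :: "real mat" and P\<^sub>1 P\<^sub>2 :: "real vec set"
  assumes "\<Sigma>\<^sub>1 \<in> Sym_plus n k" and "\<Sigma>\<^sub>2 \<in> Sym_plus n k"
    and "P\<^sub>1 = vec_space.col_space n \<Sigma>\<^sub>1" and "P\<^sub>2 = vec_space.col_space n \<Sigma>\<^sub>2"
    and "X \<in> carrier_mat n k" and "vec_space.rank n X = k" and "\<Sigma>\<^sub>1 = X * X\<^sup>T"
    and "Y \<in> carrier_mat n k" and "vec_space.rank n Y = k" and "\<Sigma>\<^sub>2 = Y * Y\<^sup>T"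
  shows "\<exists>f. bij_betw f (index_Gr n k P\<^sub>1 P\<^sub>2) (index_BW k X Y)"
proof -
  obtain Q\<^sub>1 G where Q\<^sub>1: "Q\<^sub>1 \<in> Stiefel n k" "vec_space.col_space n Q\<^sub>1 = P\<^sub>1"
    and G: "G \<in> carrier_mat k k" "det G \<noteq> 0" "X = Q\<^sub>1 * G"
    using Stiefel_factorization[OF assms(5,6)] unfolding assms(3,7) by blast
  obtain Q\<^sub>2 H where Q\<^sub>2: "Q\<^sub>2 \<in> Stiefel n k" "vec_space.col_space n Q\<^sub>2 = P\<^sub>2"
    and H: "H \<in> carrier_mat k k" "det H \<noteq> 0" "Y = Q\<^sub>2 * H"
    using Stiefel_factorization[OF assms(8,9)] unfolding assms(4,10) by blast
  let ?M = "X\<^sup>T * Y" and ?N = "Q\<^sub>1\<^sup>T * Q\<^sub>2"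
  have M: "?M \<in> carrier_mat k k" and N: "?N \<in> carrier_mat k k"
    using assms(5,8) StiefelD(1,2)[OF Q\<^sub>1(1)] StiefelD(1,2)[OF Q\<^sub>2(1)] by auto
  have MN: "?M = G\<^sup>T * ?N * H"
    unfolding G(3) H(3) by (rule gram_mult[OF StiefelD(1)[OF Q\<^sub>1(1)] G(1) StiefelD(1)[OF Q\<^sub>2(1)] H(1)])
  obtain U d V r where svd: "svd k ?M U d V r" using svd_exists[OF M] .
  obtain U' d' V' r' where svd': "svd k ?N U' d' V' r'" using svd_exists[OF N] .
  have GT: "G\<^sup>T \<in> carrier_mat k k" "det G\<^sup>T \<noteq> 0" using G by (auto simp: det_transpose[of _ k])
  obtain K where K: "K \<in> carrier_mat k k" "H * K = 1\<^sub>m k" using det_nonzero_inverse[OF H(1,2)] by blast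
  obtain L where L: "L \<in> carrier_mat k k" "L * G\<^sup>T = 1\<^sub>m k" using det_nonzero_inverse[OF GT] by blast
  note assoc = assoc_mult_mat[of _ k k _ k _ k] and closed = mult_carrier_mat[of _ k k _ k]
  \<comment> \<open>X and Y arise from the orthonormal bases by invertible G and H, so M and N have the same nullity\<close>
  have "r \<le> r'"
  proof (rule svd_nullity_le[OF svd svd' L(1) H(1,2)])
    have "L * ?M = (L * G\<^sup>T) * (?N * H)" unfolding MN using L(1) GT(1) N H(1) by (simp only: assoc closed)
    thus "?N * H = L * ?M" unfolding L(2) using left_mult_one_mat[OF closed[OF N H(1)]] by simp
  qed
  moreover have "r' \<le> r"
  proof (rule svd_nullity_le[OF svd' svd GT(1) K(1)])
    show "det K \<noteq> 0" using arg_cong[OF K(2), of det] H(1) K(1) by (auto simp: det_mult[of _ k])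
    have "?M * K = G\<^sup>T * (?N * (H * K))" unfolding MN using K(1) GT(1) N H(1) by (simp only: assoc closed)
    thus "?M * K = G\<^sup>T * ?N" unfolding K(2) right_mult_one_mat[OF N] .
  qed
  ultimately have r: "num_right_angles n k P\<^sub>1 P\<^sub>2 = r"
    using num_right_angles_svd[OF Q\<^sub>1(1) Q\<^sub>2(1) svd'] Q\<^sub>1(2) Q\<^sub>2(2) by simp
  have Gr: "index_Gr n k P\<^sub>1 P\<^sub>2 = block_identity k r ` orthogonal_group r"
    by (auto simp: index_Gr_def r Let_def block_identity_def)
  have O: "U \<in> orthogonal_group k" "V \<in> orthogonal_group k" and rk: "r \<le> k" using svd by (auto simp: svd_def)
  note U = orthogonal_groupD[OF O(1)] and V = orthogonal_groupD[OF O(2)]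
  have inverse: "V\<^sup>T * (V * W * U\<^sup>T) * U = W" if W: "W \<in> carrier_mat k k" for W
  proof -
    have "V\<^sup>T * (V * W * U\<^sup>T) * U = V\<^sup>T * (V * (W * (U\<^sup>T * U)))"
      using U(1,2) V(1,2) W by (simp add: assoc closed)
    thus ?thesis using transpose_mult_cancel(1)[OF O(2) W] U(3) W by simp
  qed
  have "index_Gr n k P\<^sub>1 P\<^sub>2 \<subseteq> carrier_mat k k"
    unfolding Gr using orthogonal_groupD(1)[OF block_identity_orthogonal[OF rk]] by blast
  hence "inj_on (\<lambda>W. V * W * U\<^sup>T) (index_Gr n k P\<^sub>1 P\<^sub>2)"
    using inverse by (intro inj_on_inverseI[where g = "\<lambda>R. V\<^sup>T * R * U"]) blast
  moreover have "(\<lambda>W. V * W * U\<^sup>T) ` index_Gr n k P\<^sub>1 P\<^sub>2 = index_BW k X Y"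
    unfolding Gr index_BW_svd[OF svd] by (simp add: image_image)
  ultimately show ?thesis by (auto intro: bij_betw_imageI)
qed

end
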